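(* Let $E$ be a symmetric space on $I=[0,\infty)$ whose fundamental function $\phi$ satisfies $\phi(t)/t\to0$ as $t\to\infty$, and let $x\in E\cap L^1$. Then the following are equivalent: (a) $x$ is an LLUKM point of $E$ and $\lim_{t\to0^+}x^*(t)\phi(t)=0$; (b) $x$ is an LKM point of $E$ and a point of order continuity of $E$.
   Context: Let $I=[0,\infty)$ with Lebesgue measure $\mu$, and let $L^0$ be the set of (equivalence classes of) extended real valued measurable functions on $I$; $L^1=L^1[0,\infty)$. A Banach function space $(E,\|\cdot\|_E)$ is a Banach lattice that is a sublattice of $L^0$ such that (1) $x\in L^0$, $y\in E$, $|x|\le|y|$ a.e. imply $x\in E$ and $\|x\|_E\le\|y\|_E$; (2) $E$ contains a strictly positive function. $E^+=\{x\in E:x\ge0\}$. For $x\in L^0$: $d_x(\lambda)=\mu\{s\in I:|x(s)|>\lambda\}$, $x^*(t)=\inf\{\lambda>0:d_x(\lambda)\le t\}$, $x^{**}(t)=\frac1t\int_0^t x^*(s)\,ds$. $E$ is symmetric if $x\in L^0$, $y\in E$, $d_x=d_y$ imply $x\in E$ and $\|x\|_E=\|y\|_E$. Its fundamental function is $\phi(t)=\|\chi_{(0,t)}\|_E$. Standing assumption: $E$ has the Fatou property, i.e. if $(x_n)\subset E^+$, $\sup_n\|x_n\|_E<\infty$ and $x_n\uparrow x\in L^0$, then $x\in E$ and $\|x_n\|_E\uparrow\|x\|_E$. For $x,y\in L^1+L^\infty$, $x\prec y$ means $x^{**}(t)\le y^{**}(t)$ for all $t>0$. $x\in E$ is a point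 of order continuity if for every $(x_n)\subset E^+$ with $x_n\le|x|$ and $x_n\to0$ a.e. we have $\|x_n\|_E\to0$. $x\in E$ is an LKM point (point of lower $K$-monotonicity) if for every $y\in E$ with $x^*\ne y^*$ and $y\prec x$ we have $\|y\|_E<\|x\|_E$. $x\in E$ is an LLUKM point (point of lower local uniform $K$-monotonicity) if for every $(x_n)\subset E$ with $x_n\prec x$ for all $n$ and $\|x_n\|_E\to\|x\|_E$ we have $\|x^*-x_n^*\|_E\to0$. *)

theory Defs
  imports "HOL-Analysis.Analysis"
begin

text \<open>
  Everything lives on \<open>I = [0,\<infinity>)\<close> with Lebesgue measure.  Elements of \<open>L0\<close> are represented by
  functions \<open>real \<Rightarrow> ereal\<close> whose values on the negative half-line are never looked at; equivalence
  classes are not formed, instead all notions below are invariant under a.e. equality on \<open>I\<close>.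
\<close>

abbreviation halfline :: "real measure" where
  "halfline \<equiv> lebesgue_on {0..}"

definition L0 :: "(real \<Rightarrow> ereal) set" where
  "L0 = borel_measurable halfline"

definition L1 :: "(real \<Rightarrow> ereal) set" where
  "L1 = {x \<in> L0. (\<integral>\<^sup>+ t. e2ennreal \<bar>x t\<bar> \<partial>halfline) < \<infinity>}"

definition distr_fun :: "(real \<Rightarrow> ereal) \<Rightarrow> real \<Rightarrow> ennreal" where
  "distr_fun x c = emeasure halfline {s \<in> {0..}. \<bar>x s\<bar> > ereal c}"

text \<open>The infimum is taken in \<open>ereal\<close>, so it is \<open>\<infinity>\<close> when no \<open>c\<close> qualifies.\<close>

definition rearr :: "(real \<Rightarrow> ereal) \<Rightarrow> real \<Rightarrow> ereal" where
  "rearr x t = Inf {ereal c | c. c > 0 \<and> distr_fun x c \<le> ennreal t}"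

definition max_rearr :: "(real \<Rightarrow> ereal) \<Rightarrow> real \<Rightarrow> ennreal" where
  "max_rearr x t = (\<integral>\<^sup>+ s \<in> {0..t}. e2ennreal (rearr x s) \<partial>halfline) / ennreal t"

text \<open>
  Submajorization is usually considered on \<open>L\<^sup>1 + L\<^sup>\<infinity>\<close>, which is where \<open>max_rearr\<close> is finite and
  which contains every symmetric space.  As \<open>max_rearr\<close> takes values in \<open>[0,\<infinity>]\<close>, no side
  condition is needed here; if \<open>y \<in> L1\<close>, then \<open>x \<in> L\<^sup>1 + L\<^sup>\<infinity>\<close> follows for every \<open>x \<in> L0\<close>
  that is submajorized by \<open>y\<close>.
\<close>

definition submaj :: "(real \<Rightarrow> ereal) \<Rightarrow> (real \<Rightarrow> ereal) \<Rightarrow> bool" where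
  "submaj x y \<longleftrightarrow> (\<forall>t>0. max_rearr x t \<le> max_rearr y t)"

text \<open>
  A Banach function space is given by a set \<open>E\<close> of functions and a map \<open>N\<close> that is only relevant on
  \<open>E\<close>.  A vector space of extended real valued functions must consist of a.e. finite functions
  (\<open>ae_finite\<close>), so that the \<open>ereal\<close> sums and differences below are well behaved a.e.
  Well-definedness of \<open>N\<close> on equivalence classes and monotonicity of the norm are part of \<open>ideal\<close>.
\<close>

locale banach_function_space =
  fixes E :: "(real \<Rightarrow> ereal) set" and N :: "(real \<Rightarrow> ereal) \<Rightarrow> real"
  assumes measurable: "x \<in> E \<Longrightarrow> x \<in> L0"
    and ae_finite: "x \<in> E \<Longrightarrow> AE t in halfline. \<bar>x t\<bar> \<noteq> \<infinity>"
    and add: "\<lbrakk>x \<in> E; y \<in> E\<rbrakk> \<Longrightarrow> (\<lambda>t. x t + y t) \<in> E"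
    and scale: "x \<in> E \<Longrightarrow> (\<lambda>t. ereal c * x t) \<in> E"
    and sup: "\<lbrakk>x \<in> E; y \<in> E\<rbrakk> \<Longrightarrow> (\<lambda>t. max (x t) (y t)) \<in> E"
    and inf: "\<lbrakk>x \<in> E; y \<in> E\<rbrakk> \<Longrightarrow> (\<lambda>t. min (x t) (y t)) \<in> E"
    and norm_nonneg: "x \<in> E \<Longrightarrow> 0 \<le> N x"
    and norm_eq_0: "x \<in> E \<Longrightarrow> N x = 0 \<longleftrightarrow> (AE t in halfline. x t = 0)"
    and norm_triangle: "\<lbrakk>x \<in> E; y \<in> E\<rbrakk> \<Longrightarrow> N (\<lambda>t. x t + y t) \<le> N x + N y"
    and norm_scale: "x \<in> E \<Longrightarrow> N (\<lambda>t. ereal c * x t) = \<bar>c\<bar> * N x"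
    and complete:
      "\<lbrakk>\<And>n. X n \<in> E;
        \<And>e. e > 0 \<Longrightarrow> \<exists>M. \<forall>m\<ge>M. \<forall>n\<ge>M. N (\<lambda>t. X m t - X n t) < e\<rbrakk>
       \<Longrightarrow> \<exists>x\<in>E. (\<lambda>n. N (\<lambda>t. X n t - x t)) \<longlonglongrightarrow> 0"
    and ideal:
      "\<lbrakk>x \<in> L0; y \<in> E; AE t in halfline. \<bar>x t\<bar> \<le> \<bar>y t\<bar>\<rbrakk> \<Longrightarrow> x \<in> E \<and> N x \<le> N y"
    and strictly_positive: "\<exists>x\<in>E. AE t in halfline. x t > 0"

locale symmetric_space = banach_function_space +
  assumes symmetric:
    "\<lbrakk>x \<in> L0; y \<in> E; distr_fun x = distr_fun y\<rbrakk> \<Longrightarrow> x \<in> E \<and> N x = N y"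

definition positive_cone :: "(real \<Rightarrow> ereal) set \<Rightarrow> (real \<Rightarrow> ereal) set" where
  "positive_cone E = {x \<in> E. AE t in halfline. 0 \<le> x t}"

definition fatou_property ::
  "(real \<Rightarrow> ereal) set \<Rightarrow> ((real \<Rightarrow> ereal) \<Rightarrow> real) \<Rightarrow> bool" where
  "fatou_property E N \<longleftrightarrow>
    (\<forall>X x. (\<forall>n. X n \<in> positive_cone E) \<and> bdd_above (range (\<lambda>n. N (X n))) \<and> x \<in> L0 \<and>
       (AE t in halfline. incseq (\<lambda>n. X n t) \<and> (\<lambda>n. X n t) \<longlonglongrightarrow> x t)
     \<longrightarrow> x \<in> E \<and> incseq (\<lambda>n. N (X n)) \<and> (\<lambda>n. N (X n)) \<longlonglongrightarrow> N x)"

definition fundamental_fun :: "((real \<Rightarrow> ereal) \<Rightarrow> real) \<Rightarrow> real \<Rightarrow> real" where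
  "fundamental_fun N t = N (indicator {0<..<t})"

definition order_continuity_point ::
  "(real \<Rightarrow> ereal) set \<Rightarrow> ((real \<Rightarrow> ereal) \<Rightarrow> real) \<Rightarrow> (real \<Rightarrow> ereal) \<Rightarrow> bool" where
  "order_continuity_point E N x \<longleftrightarrow> x \<in> E \<and>
    (\<forall>X. (\<forall>n. X n \<in> positive_cone E) \<and>
         (\<forall>n. AE t in halfline. X n t \<le> \<bar>x t\<bar>) \<and>
         (AE t in halfline. (\<lambda>n. X n t) \<longlonglongrightarrow> 0)
       \<longrightarrow> (\<lambda>n. N (X n)) \<longlonglongrightarrow> 0)"

definition LKM_point ::
  "(real \<Rightarrow> ereal) set \<Rightarrow> ((real \<Rightarrow> ereal) \<Rightarrow> real) \<Rightarrow> (real \<Rightarrow> ereal) \<Rightarrow> bool" where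
  "LKM_point E N x \<longleftrightarrow> x \<in> E \<and>
    (\<forall>y\<in>E. (\<exists>t\<ge>0. rearr x t \<noteq> rearr y t) \<and> submaj y x \<longrightarrow> N y < N x)"

definition LLUKM_point ::
  "(real \<Rightarrow> ereal) set \<Rightarrow> ((real \<Rightarrow> ereal) \<Rightarrow> real) \<Rightarrow> (real \<Rightarrow> ereal) \<Rightarrow> bool" where
  "LLUKM_point E N x \<longleftrightarrow> x \<in> E \<and>
    (\<forall>X. (\<forall>n. X n \<in> E) \<and> (\<forall>n. submaj (X n) x) \<and> (\<lambda>n. N (X n)) \<longlonglongrightarrow> N x
       \<longrightarrow> (\<lambda>n. N (\<lambda>t. rearr x t - rearr (X n) t)) \<longlonglongrightarrow> 0)"

end

theory Submission
  imports Defs "HOL-Probability.Helly_Selection"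
begin

text \<open>
  Because of the Fatou property \<open>E\<close> is fully symmetric: \<open>y \<prec> x\<close> implies \<open>N y \<le> N x\<close>.  Approximating
  from below by dyadic step functions reduces this to the Hardy--Littlewood--Polya transfer
  argument for finite sequences.  Consequently a function bounded by \<open>M\<close> with integral at most
  \<open>M \<tau>\<close> has norm at most \<open>M \<phi>(\<tau>)\<close>, so that bounded functions tending to \<open>0\<close> in \<open>L\<^sup>1\<close> tend to \<open>0\<close>
  in \<open>E\<close> as soon as \<open>\<phi>(0+) = 0\<close>.  Hence, for \<open>x \<noteq> 0\<close> in \<open>E \<inter> L\<^sup>1\<close>, order continuity at \<open>x\<close> amounts
  to \<open>\<phi>(0+) = 0\<close> together with \<open>(\<bar>x\<bar> - k)\<^sup>+ \<rightarrow> 0\<close> in \<open>E\<close>.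

  An LLUKM point is an LKM point (constant sequences), and testing it with \<open>min \<bar>x\<bar> n\<close> gives
  \<open>(\<bar>x\<bar> - n)\<^sup>+ \<rightarrow> 0\<close>.  Conversely, let \<open>x\<^sub>n \<prec> x\<close> with \<open>N x\<^sub>n \<rightarrow> N x\<close>.  By Helly's theorem a
  subsequence of \<open>x\<^sub>n\<^sup>*\<close> converges a.e. to some decreasing \<open>z \<prec> x\<close>.  The convergence takes place in
  \<open>E\<close>: the parts above a level \<open>k\<close> are submajorized by \<open>(x\<^sup>* - k)\<^sup>+\<close>, the truncated parts converge in
  \<open>L\<^sup>1\<close> on \<open>[0, T]\<close>, and the tails on \<open>[T, \<infinity>)\<close> are bounded by a multiple of \<open>1/T\<close> with bounded
  integral, hence controlled by \<open>\<phi>(2T)/(2T)\<close>.  So \<open>N z = N x\<close>, and the LKM property forces \<open>z = x\<^sup>*\<close>.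
\<close>

section \<open>Decreasing rearrangement\<close>

lemma space_halfline [simp]: "space halfline = {0..}"
  by (simp add: space_restrict_space)

lemma emeasure_halfline: "A \<subseteq> {0..} \<Longrightarrow> emeasure halfline A = emeasure lebesgue A"
  by (rule emeasure_restrict_space) auto

lemma emeasure_halfline_borel:
  "A \<in> sets borel \<Longrightarrow> A \<subseteq> {0..} \<Longrightarrow> emeasure halfline A = emeasure lborel A"
  by (simp add: emeasure_halfline)

lemma sets_halflineI: "A \<in> sets borel \<Longrightarrow> A \<subseteq> {0..} \<Longrightarrow> A \<in> sets halfline"
  by (auto simp: sets_restrict_space_iff)

lemma emeasure_halfline_Ico: "0 \<le> a \<Longrightarrow> a \<le> b \<Longrightarrow> emeasure halfline {a..<b} = ennreal (b - a)"
  by (subst emeasure_halfline_borel) auto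

lemma emeasure_halfline_Ioo: "0 \<le> a \<Longrightarrow> a \<le> b \<Longrightarrow> emeasure halfline {a<..<b} = ennreal (b - a)"
  by (subst emeasure_halfline_borel) auto

text \<open>Intervals of positive length are not null. This turns a.e. information about monotone
  functions into information at nearby points.\<close>

lemma AE_halfline_ex_Ico:
  assumes "AE s in halfline. P s" "0 \<le> a" "a < b" shows "\<exists>s\<in>{a..<b}. P s"
proof (rule ccontr)
  assume neg: "\<not> ?thesis"
  from AE_E[OF assms(1)] obtain Z where Z: "{s \<in> space halfline. \<not> P s} \<subseteq> Z"
    "emeasure halfline Z = 0" "Z \<in> sets halfline" by blast
  have "{a..<b} \<subseteq> Z" using Z(1) neg assms(2) by auto
  then have "emeasure halfline {a..<b} \<le> emeasure halfline Z" using Z(3) by (rule emeasure_mono)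
  then show False using assms(2,3) by (simp add: Z(2) emeasure_halfline_Ico)
qed

lemma emeasure_halfline_UNIV: "emeasure halfline {0..} = \<infinity>"
proof -
  have "ennreal (real n) \<le> emeasure halfline {0..}" for n
  proof -
    have "emeasure halfline {0..<real n} \<le> emeasure halfline {0..}"
      by (rule emeasure_mono) (auto intro: sets_halflineI)
    then show ?thesis by (simp add: emeasure_halfline_Ico)
  qed
  then have "(SUP n. of_nat n) \<le> emeasure halfline {0..}"
    by (intro SUP_least) (simp add: ennreal_of_nat_eq_real_of_nat)
  then show ?thesis
    by (simp add: ennreal_SUP_of_nat_eq_top top_unique)
qed

text \<open>With \<open>d = distr_fun x c\<close> this is the measure of a superlevel set of
  \<open>rearr x\<close>; \<open>d\<close> may be infinite.\<close>

lemma emeasure_halfline_below: "emeasure halfline {s \<in> {0..}. ennreal s < d} = d"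
proof (cases d)
  case (real r)
  then have "{s \<in> {0..}. ennreal s < d} = {0..<r}"
    by (auto simp: ennreal_less_iff)
  then show ?thesis
    using real by (simp add: emeasure_halfline_Ico)
next
  case top
  then show ?thesis
    using emeasure_halfline_UNIV by (simp add: atLeast_def)
qed

lemma measurable_restrict_borel: "f \<in> borel_measurable borel \<Longrightarrow> f \<in> borel_measurable halfline"
  by (intro measurable_restrict_space1 measurable_completion) simp

section \<open>Distribution functions\<close>

lemma L0_abs_gt_sets: "x \<in> L0 \<Longrightarrow> {s \<in> {0..}. \<bar>x s\<bar> > ereal c} \<in> sets halfline"
proof -
  assume "x \<in> L0"
  then have [measurable]: "x \<in> borel_measurable halfline" by (simp add: L0_def)
  have "{s \<in> space halfline. \<bar>x s\<bar> > ereal c} \<in> sets halfline" by measurable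
  then show ?thesis by simp
qed

lemma distr_fun_antimono:
  assumes "x \<in> L0" "c \<le> d" shows "distr_fun x d \<le> distr_fun x c"
  unfolding distr_fun_def
proof (rule emeasure_mono)
  show "{s \<in> {0..}. ereal d < \<bar>x s\<bar>} \<subseteq> {s \<in> {0..}. ereal c < \<bar>x s\<bar>}"
    using assms(2) by (auto intro: le_less_trans[of "ereal c" "ereal d"])
qed (rule L0_abs_gt_sets[OF assms(1)])

text \<open>Settles the negative levels, which the definition admits, so that equality of
  distribution functions has to be checked only for \<open>0 \<le> c\<close>.\<close>

lemma distr_fun_neg: "c < 0 \<Longrightarrow> distr_fun x c = \<infinity>"
proof -
  assume "c < 0"
  then have "ereal c < \<bar>x s\<bar>" for s
    by (intro less_le_trans[of "ereal c" 0 "\<bar>x s\<bar>"]) auto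
  then have "{s \<in> {0..}. \<bar>x s\<bar> > ereal c} = {0..}" by auto
  then show ?thesis
    by (simp only: distr_fun_def emeasure_halfline_UNIV)
qed

lemma distr_fun_eqI:
  assumes "\<And>c. 0 \<le> c \<Longrightarrow> distr_fun x c = distr_fun y c"
  shows "distr_fun x = distr_fun y"
  using assms distr_fun_neg by (metis ext not_le)

lemma distr_fun_mono:
  assumes "y \<in> L0" "AE t in halfline. \<bar>x t\<bar> \<le> \<bar>y t\<bar>"
  shows "distr_fun x c \<le> distr_fun y c"
  unfolding distr_fun_def
proof (rule emeasure_mono_AE)
  show "AE s in halfline. s \<in> {s \<in> {0..}. ereal c < \<bar>x s\<bar>} \<longrightarrow> s \<in> {s \<in> {0..}. ereal c < \<bar>y s\<bar>}"
    using assms(2) by eventually_elim (auto intro: less_le_trans)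
qed (rule L0_abs_gt_sets[OF assms(1)])

text \<open>The sets where \<open>\<bar>x\<bar> > c + 1 / (n + 1)\<close> increase to the set where
  \<open>\<bar>x\<bar> > c\<close>, so continuity of the measure from below applies.\<close>

lemma distr_fun_right_cont:
  assumes "x \<in> L0" "a < distr_fun x c" shows "\<exists>c'>c. a < distr_fun x c'"
proof -
  let ?A = "\<lambda>n. {s \<in> {0..}. ereal (c + 1 / real (Suc n)) < \<bar>x s\<bar>}"
  have "(SUP n. emeasure halfline (?A n)) = emeasure halfline (\<Union>n. ?A n)"
  proof (rule SUP_emeasure_incseq)
    show "range ?A \<subseteq> sets halfline" using L0_abs_gt_sets[OF assms(1)] by blast
    show "incseq ?A"
    proof (rule incseq_SucI)
      fix n
      have "1 / real (Suc (Suc n)) \<le> 1 / real (Suc n)" by (intro divide_left_mono) auto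
      then show "?A n \<le> ?A (Suc n)"
        by (auto intro: le_less_trans[rotated])
    qed
  qed
  also have "(\<Union>n. ?A n) = {s \<in> {0..}. ereal c < \<bar>x s\<bar>}"
  proof (intro equalityI subsetI)
    fix s assume "s \<in> {s \<in> {0..}. ereal c < \<bar>x s\<bar>}"
    then have s: "0 \<le> s" "ereal c < \<bar>x s\<bar>" by auto
    from ereal_dense2[OF s(2)] obtain r where r: "ereal c < ereal r" "ereal r < \<bar>x s\<bar>" by blast
    then obtain n where "inverse (real (Suc n)) < r - c"
      using reals_Archimedean[of "r - c"] by auto
    then have "ereal (c + 1 / real (Suc n)) < ereal r" by (simp add: inverse_eq_divide)
    then have "s \<in> ?A n" using s r by (blast intro: less_trans)
    then show "s \<in> (\<Union>n. ?A n)" by blast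
  qed (auto intro: le_less_trans[rotated])
  finally have "a < (SUP n. emeasure halfline (?A n))"
    using assms(2) by (simp add: distr_fun_def)
  then obtain n where "a < emeasure halfline (?A n)" by (auto simp: less_SUP_iff)
  then show ?thesis
    by (intro exI[of _ "c + 1 / real (Suc n)"]) (simp add: distr_fun_def)
qed

section \<open>The decreasing rearrangement and its level sets\<close>

lemma rearr_nonneg: "0 \<le> rearr x t"
  unfolding rearr_def by (rule Inf_greatest) auto

text \<open>The rearrangement is the generalized inverse of the distribution function. Right
  continuity of the latter makes the equivalence exact for strict inequalities; nearly every later
  fact about \<open>rearr\<close> goes through it.\<close>

lemma rearr_gt_iff:
  assumes "x \<in> L0" "0 \<le> c"
  shows "ereal c < rearr x t \<longleftrightarrow> ennreal t < distr_fun x c"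
proof
  assume "ennreal t < distr_fun x c"
  then obtain c' where c': "c < c'" "ennreal t < distr_fun x c'"
    using distr_fun_right_cont[OF assms(1)] by blast
  have "ereal c' \<le> rearr x t"
    unfolding rearr_def
  proof (rule Inf_greatest)
    fix e assume "e \<in> {ereal c |c. 0 < c \<and> distr_fun x c \<le> ennreal t}"
    then obtain b where b: "e = ereal b" "distr_fun x b \<le> ennreal t" by auto
    with c' have "\<not> b \<le> c'" using distr_fun_antimono[OF assms(1), of b c'] by (meson leD order_trans)
    then show "ereal c' \<le> e" using b by simp
  qed
  with c' show "ereal c < rearr x t" by (simp add: less_le_trans[of _ "ereal c'"])
next
  show "ennreal t < distr_fun x c" if gt: "ereal c < rearr x t"
  proof (rule ccontr)
    assume "\<not> ennreal t < distr_fun x c"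
    then have le: "distr_fun x c \<le> ennreal t" by simp
    \<comment> \<open>The level is raised to some \<open>r > c\<close>, since \<open>c\<close> may
      be \<open>0\<close> and the infimum ranges over positive levels only.\<close>
    from ereal_dense2[OF gt] obtain r where r: "c < r" "ereal r < rearr x t" by auto
    have "distr_fun x r \<le> ennreal t"
      using distr_fun_antimono[OF assms(1), of c r] r le by auto
    then have "rearr x t \<le> ereal r"
      unfolding rearr_def using r assms(2) by (intro Inf_lower) auto
    with r show False by simp
  qed
qed

text \<open>For a decreasing function the last clause is right continuity, expressed through strict
  superlevel sets and hence free of limits in \<open>ereal\<close>. On the half-line these are
  exactly the functions that equal their own rearrangement.\<close>

definition decreasing_rcont :: "(real \<Rightarrow> ereal) \<Rightarrow> bool" where
  "decreasing_rcont f \<longleftrightarrow> (\<forall>t. 0 \<le> f t) \<and> (\<forall>s t. s \<le> t \<longrightarrow> f t \<le> f s) \<and>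
     (\<forall>t c. ereal c < f t \<longrightarrow> (\<exists>t'>t. ereal c < f t'))"

lemma decreasing_rcontD:
  assumes "decreasing_rcont f"
  shows "0 \<le> f t" "s \<le> t \<Longrightarrow> f t \<le> f s" "ereal c < f t \<Longrightarrow> \<exists>t'>t. ereal c < f t'"
  using assms unfolding decreasing_rcont_def by simp_all

lemma decreasing_rcont_rearr:
  assumes "x \<in> L0" shows "decreasing_rcont (rearr x)"
  unfolding decreasing_rcont_def
proof (intro conjI allI impI)
  fix s t :: real assume "s \<le> t"
  then have "ennreal s \<le> ennreal t" by (rule ennreal_leI)
  then show "rearr x t \<le> rearr x s"
    unfolding rearr_def by (intro Inf_superset_mono) (auto intro: order_trans)
next
  fix t c assume gt: "ereal c < rearr x t"
  show "\<exists>t'>t. ereal c < rearr x t'"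
  proof (cases "c < 0")
    case True
    then have "ereal c < rearr x (t + 1)"
      by (intro less_le_trans[OF _ rearr_nonneg]) simp
    then show ?thesis
      by (intro exI[of _ "t + 1"]) simp
  next
    case False
    then have "ennreal t < distr_fun x c" using gt assms by (simp add: rearr_gt_iff)
    \<comment> \<open>A value strictly in between is finite, whereas \<open>distr_fun x c\<close>
      may be infinite.\<close>
    then obtain a where a: "ennreal t < a" "a < distr_fun x c" using dense by blast
    then obtain r where "a = ennreal r" by (cases a) auto
    with a have r: "ennreal t < ennreal r" "ennreal r < distr_fun x c" by auto
    have "t < r" using r(1) by (meson ennreal_leI not_le)
    moreover have "ereal c < rearr x r" using r(2) assms False by (simp add: rearr_gt_iff)
    ultimately show ?thesis by blast
  qed
qed (rule rearr_nonneg)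

lemma decreasing_rcont_L0:
  assumes "decreasing_rcont f" shows "f \<in> L0"
proof -
  have "f \<in> borel_measurable borel"
  proof (rule borel_measurableI_greater)
    fix y
    have "is_interval {t. y < f t}"
      unfolding is_interval_1 using decreasing_rcontD(2)[OF assms] less_le_trans by blast
    then show "{t \<in> space borel. y < f t} \<in> sets borel"
      by (simp add: real_interval_borel_measurable)
  qed
  then show ?thesis by (simp add: L0_def measurable_restrict_borel)
qed

lemma rearr_L0: "x \<in> L0 \<Longrightarrow> rearr x \<in> L0"
  by (rule decreasing_rcont_L0) (rule decreasing_rcont_rearr)

text \<open>By \<open>rearr_gt_iff\<close> the superlevel set of \<open>rearr x\<close> at
  \<open>c\<close> is the initial interval of length \<open>distr_fun x c\<close>.\<close>

lemma distr_fun_rearr: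
  assumes "x \<in> L0" shows "distr_fun (rearr x) = distr_fun x"
proof (rule distr_fun_eqI)
  fix c :: real assume "0 \<le> c"
  then have "{s \<in> {0..}. ereal c < \<bar>rearr x s\<bar>} = {s \<in> {0..}. ennreal s < distr_fun x c}"
    using assms by (auto simp: rearr_gt_iff rearr_nonneg)
  then show "distr_fun (rearr x) c = distr_fun x c"
    unfolding distr_fun_def[of "rearr x"] by (simp only: emeasure_halfline_below)
qed

lemma ereal_eqI_real_lt:
  fixes a b :: ereal
  assumes "0 \<le> a" "0 \<le> b" "\<And>c. 0 \<le> c \<Longrightarrow> ereal c < a \<longleftrightarrow> ereal c < b"
  shows "a = b"
proof (rule ccontr)
  assume "a \<noteq> b"
  then consider "a < b" | "b < a" by (meson linorder_neqE)
  then show False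
  proof cases
    case 1
    then obtain r where "a < ereal r" "ereal r < b" using ereal_dense2 by blast
    moreover from this(1) have "0 < ereal r" by (rule le_less_trans[OF assms(1)])
    ultimately show False using assms(3)[of r] by auto
  next
    case 2
    then obtain r where "b < ereal r" "ereal r < a" using ereal_dense2 by blast
    moreover from this(1) have "0 < ereal r" by (rule le_less_trans[OF assms(2)])
    ultimately show False using assms(3)[of r] by auto
  qed
qed

text \<open>Superlevel sets of \<open>f\<close> are initial intervals. Right continuity gives a
  point \<open>t' > t\<close> at the same level, so that the length of such an interval strictly
  exceeds \<open>t\<close>.\<close>

lemma rearr_decreasing_rcont:
  assumes f: "decreasing_rcont f" and t: "0 \<le> t" shows "rearr f t = f t"
proof (rule ereal_eqI_real_lt)
  fix c :: real assume c: "0 \<le> c"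
  have fL0: "f \<in> L0" using f by (rule decreasing_rcont_L0)
  have abs: "\<bar>f s\<bar> = f s" for s using decreasing_rcontD(1)[OF f] by simp
  show "ereal c < rearr f t \<longleftrightarrow> ereal c < f t"
  proof
    assume "ereal c < f t"
    then obtain t' where t': "t < t'" "ereal c < f t'" using decreasing_rcontD(3)[OF f] by blast
    then have "{0..<t'} \<subseteq> {s \<in> {0..}. ereal c < \<bar>f s\<bar>}"
      using less_le_trans[OF t'(2) decreasing_rcontD(2)[OF f]] by (auto simp: abs)
    then have "emeasure halfline {0..<t'} \<le> distr_fun f c"
      unfolding distr_fun_def by (rule emeasure_mono) (rule L0_abs_gt_sets[OF fL0])
    then have "ennreal t' \<le> distr_fun f c" using t t' by (simp add: emeasure_halfline_Ico)
    moreover have "ennreal t < ennreal t'" using t t' by (simp add: ennreal_less_iff)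
    ultimately show "ereal c < rearr f t" by (simp add: rearr_gt_iff fL0 c)
  next
    assume "ereal c < rearr f t"
    then have gt: "ennreal t < distr_fun f c" by (simp add: rearr_gt_iff fL0 c)
    have "\<exists>s\<ge>t. ereal c < f s"
    proof (rule ccontr)
      assume "\<not> ?thesis"
      then have "{s \<in> {0..}. ereal c < \<bar>f s\<bar>} \<subseteq> {0..<t}" by (auto simp: abs not_le)
      then have "distr_fun f c \<le> emeasure halfline {0..<t}"
        unfolding distr_fun_def by (rule emeasure_mono) (auto intro: sets_halflineI)
      then show False using gt t by (simp add: emeasure_halfline_Ico)
    qed
    then show "ereal c < f t" using decreasing_rcontD(2)[OF f] less_le_trans by blast
  qed
qed (use decreasing_rcontD(1)[OF f] rearr_nonneg in auto)

lemma rearr_cong: "distr_fun x = distr_fun y \<Longrightarrow> rearr x = rearr y"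
  by (simp add: rearr_def fun_eq_iff)

lemma rearr_eq_zero:
  assumes "x \<in> L0" "AE t in halfline. x t = 0" shows "rearr x t = 0"
proof -
  have "distr_fun x 0 \<le> distr_fun (\<lambda>_. 0) 0"
    using assms by (intro distr_fun_mono) (auto simp: L0_def)
  also have "\<dots> = 0" by (simp add: distr_fun_def)
  finally have "\<not> ereal 0 < rearr x t" using rearr_gt_iff[OF assms(1), of 0 t] by simp
  then show ?thesis using rearr_nonneg[of x t] by (simp add: zero_ereal_def[symmetric])
qed

section \<open>The layer cake formula and integrals of rearrangements\<close>

lemma sigma_finite_halfline: "sigma_finite_measure halfline"
proof (rule sigma_finite_measure.intro, intro exI conjI ballI)
  show "\<Union>(range (\<lambda>n. {0..<real n})) = space halfline"
    using reals_Archimedean2 by auto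
qed (auto simp: emeasure_halfline_Ico intro: sets_halflineI)

text \<open>Tonelli for the indicator of the region under the graph of \<open>\<bar>x\<bar>\<close>.
  Consequently the integral depends on the distribution function alone.\<close>

lemma nn_integral_abs_layer_cake:
  assumes "x \<in> L0"
  shows "(\<integral>\<^sup>+ t. e2ennreal \<bar>x t\<bar> \<partial>halfline) = (\<integral>\<^sup>+ c. distr_fun x c * indicator {0..} c \<partial>lborel)"
proof -
  have [measurable]: "x \<in> borel_measurable halfline" using assms by (simp add: L0_def)
  interpret H: sigma_finite_measure halfline
    by (rule sigma_finite_halfline)
  interpret P: pair_sigma_finite halfline lborel ..
  define f :: "real \<Rightarrow> real \<Rightarrow> ennreal"
    where "f s c = indicator {(s, c). 0 \<le> c \<and> ereal c < \<bar>x s\<bar>} (s, c)" for s c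
  have f_meas: "case_prod f \<in> borel_measurable (halfline \<Otimes>\<^sub>M lborel)"
    unfolding f_def case_prod_beta by measurable
  have 1: "(\<integral>\<^sup>+ c. f s c \<partial>lborel) = e2ennreal \<bar>x s\<bar>" for s
  proof -
    have "(\<integral>\<^sup>+ c. f s c \<partial>lborel) = (\<integral>\<^sup>+ c. indicator {c. 0 \<le> c \<and> ereal c < \<bar>x s\<bar>} c \<partial>lborel)"
      by (intro nn_integral_cong) (simp add: f_def indicator_def)
    also have "\<dots> = emeasure lborel {c. 0 \<le> c \<and> ereal c < \<bar>x s\<bar>}"
      by (intro nn_integral_indicator) simp
    also have "\<dots> = e2ennreal \<bar>x s\<bar>"
    proof (cases "\<bar>x s\<bar>")
      case (real r)
      have "0 \<le> r" using abs_ereal_pos[of "x s"] real by simp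
      have "{c. 0 \<le> c \<and> ereal c < \<bar>x s\<bar>} = {0..<r}" using real by auto
      then show ?thesis using real \<open>0 \<le> r\<close> by simp
    next
      case PInf
      then have "{c. 0 \<le> c \<and> ereal c < \<bar>x s\<bar>} = {0..}" by auto
      then show ?thesis using PInf emeasure_halfline_UNIV
        by (simp add: emeasure_halfline)
    next
      case MInf
      then show ?thesis using abs_ereal_pos[of "x s"] by simp
    qed
    finally show ?thesis .
  qed
  have 2: "(\<integral>\<^sup>+ s. f s c \<partial>halfline) = distr_fun x c * indicator {0..} c" for c
  proof (cases "0 \<le> c")
    case True
    then have "(\<integral>\<^sup>+ s. f s c \<partial>halfline) = (\<integral>\<^sup>+ s. indicator {s \<in> {0..}. ereal c < \<bar>x s\<bar>} s \<partial>halfline)"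
      by (intro nn_integral_cong) (simp add: f_def indicator_def)
    then show ?thesis using True L0_abs_gt_sets[OF assms] by (simp add: distr_fun_def)
  qed (simp add: f_def)
  show ?thesis
    using P.Fubini'[OF f_meas] by (simp add: 1 2)
qed

lemma nn_integral_abs_cong_distr:
  assumes "x \<in> L0" "y \<in> L0" "distr_fun x = distr_fun y"
  shows "(\<integral>\<^sup>+ t. e2ennreal \<bar>x t\<bar> \<partial>halfline) = (\<integral>\<^sup>+ t. e2ennreal \<bar>y t\<bar> \<partial>halfline)"
  using assms by (simp add: nn_integral_abs_layer_cake)

lemma nn_integral_rearr:
  assumes "x \<in> L0"
  shows "(\<integral>\<^sup>+ t. e2ennreal (rearr x t) \<partial>halfline) = (\<integral>\<^sup>+ t. e2ennreal \<bar>x t\<bar> \<partial>halfline)"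
  using nn_integral_abs_cong_distr[OF rearr_L0[OF assms] assms distr_fun_rearr[OF assms]]
  by (simp add: rearr_nonneg)

section \<open>Primitives of rearrangements and submajorization\<close>

definition prim :: "(real \<Rightarrow> ereal) \<Rightarrow> real \<Rightarrow> ennreal" where
  "prim f t = (\<integral>\<^sup>+ s \<in> {0..t}. e2ennreal (f s) \<partial>halfline)"

text \<open>\<open>prim (rearr x) t\<close> is \<open>t\<close> times \<open>max_rearr x t\<close>;
  the factor \<open>t\<close> is positive and finite and can be cleared in
  \<open>ennreal\<close>.\<close>

lemma submaj_iff: "submaj x y \<longleftrightarrow> (\<forall>t>0. prim (rearr x) t \<le> prim (rearr y) t)"
proof -
  have "max_rearr x t \<le> max_rearr y t \<longleftrightarrow> prim (rearr x) t \<le> prim (rearr y) t" if "t > 0" for t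
  proof
    assume le: "max_rearr x t \<le> max_rearr y t"
    have eq: "max_rearr w t * ennreal t = prim (rearr w) t" for w
      using that by (simp add: max_rearr_def prim_def ennreal_divide_times)
    show "prim (rearr x) t \<le> prim (rearr y) t"
      using mult_right_mono[OF le, of "ennreal t"] by (simp add: eq)
  qed (auto simp: max_rearr_def prim_def intro: divide_right_mono_ennreal)
  then show ?thesis by (simp add: submaj_def)
qed

lemma prim_cong: "(\<And>s. 0 \<le> s \<Longrightarrow> f s = g s) \<Longrightarrow> prim f t = prim g t"
  unfolding prim_def by (intro nn_integral_cong) (auto simp: indicator_def)

lemma prim_mono: "(\<And>s. 0 \<le> s \<Longrightarrow> f s \<le> g s) \<Longrightarrow> prim f t \<le> prim g t"
  unfolding prim_def by (intro nn_integral_mono) (auto simp: indicator_def e2ennreal_mono)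

lemma prim_le_integral: "prim f t \<le> (\<integral>\<^sup>+ s. e2ennreal (f s) \<partial>halfline)"
  unfolding prim_def by (intro nn_integral_mono) (auto simp: indicator_def)

lemma prim_rearr_decreasing_rcont: "decreasing_rcont f \<Longrightarrow> prim (rearr f) t = prim f t"
  by (intro prim_cong rearr_decreasing_rcont)

section \<open>Majorization of finite sequences and step functions\<close>

text \<open>
  Each induction step replaces \<open>b\<close> by a convex combination of \<open>b\<close> and \<open>b \<circ> transpose j k\<close> that
  agrees with \<open>a\<close> at one more index; \<open>b\<close> stays arbitrary because only \<open>a\<close> needs to be decreasing.
\<close>

lemma weak_majorization_convex_symmetric_le:
  fixes F :: "(nat \<Rightarrow> real) \<Rightarrow> real"
  assumes mono: "\<And>u v. (\<And>i. i < n \<Longrightarrow> 0 \<le> u i \<and> u i \<le> v i) \<Longrightarrow> F u \<le> F v"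
    and swap: "\<And>u j k. j < n \<Longrightarrow> k < n \<Longrightarrow> F (u \<circ> Transposition.transpose j k) \<le> F u"
    and convex: "\<And>u v \<theta>. 0 \<le> \<theta> \<Longrightarrow> \<theta> \<le> 1 \<Longrightarrow>
      F (\<lambda>i. (1 - \<theta>) * u i + \<theta> * v i) \<le> (1 - \<theta>) * F u + \<theta> * F v"
    and a_nonneg: "\<And>i. i < n \<Longrightarrow> 0 \<le> a i"
    and a_dec: "\<And>i j. i \<le> j \<Longrightarrow> j < n \<Longrightarrow> a j \<le> a i"
    and major: "\<And>p. p \<le> n \<Longrightarrow> (\<Sum>i<p. a i) \<le> (\<Sum>i<p. b i)"
  shows "F a \<le> F b"
  using major
proof (induction "card {i \<in> {..<n}. a i \<noteq> b i}" arbitrary: b rule: less_induct)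
  case less
  show ?case
  proof (cases "\<forall>i<n. a i \<le> b i")
    case True
    then show ?thesis using a_nonneg by (intro mono) auto
  next
    case False
    \<comment> \<open>The first index at which \<open>b\<close> falls short of \<open>a\<close>. As
      the partial sums up to and including \<open>k\<close> are still in the right order, some
      earlier \<open>j\<close> must carry a surplus.\<close>
    define k where "k = (LEAST i. i < n \<and> b i < a i)"
    have "\<exists>i. i < n \<and> b i < a i" using False by auto
    from LeastI_ex[OF this] have k: "k < n" "b k < a k" unfolding k_def by blast+
    have below: "a i \<le> b i" if "i < k" for i
      using not_less_Least[of i "\<lambda>i. i < n \<and> b i < a i"] that k(1) by (auto simp: k_def[symmetric])
    have "\<exists>j<k. a j < b j"
    proof (rule ccontr)
      assume "\<not> ?thesis"
      then have "(\<Sum>i<k. a i) = (\<Sum>i<k. b i)"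
        using below by (intro sum.cong) force+
      then show False using less.prems[of "Suc k"] k by simp
    qed
    then obtain j where j: "j < k" "a j < b j" by blast
    \<comment> \<open>The largest transfer from \<open>j\<close> to \<open>k\<close> that overshoots
      at neither index. It produces equality at one of them, so the number of disagreements
      drops.\<close>
    define \<delta> where "\<delta> = min (b j - a j) (a k - b k)"
    have \<delta>: "0 < \<delta>" "\<delta> \<le> b j - a j" "\<delta> \<le> a k - b k" using j k by (auto simp: \<delta>_def)
    have "a k \<le> a j" using a_dec[of j k] j k by simp
    \<comment> \<open>Since \<open>b j > a j \<ge> a k > b k\<close>, this weight is at most 1;
      mixing \<open>b\<close> with its transposition then moves exactly \<open>\<delta>\<close> from
      \<open>j\<close> to \<open>k\<close>.\<close>
    define \<theta> where "\<theta> = \<delta> / (b j - b k)"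
    have pos: "0 < b j - b k" using j k \<open>a k \<le> a j\<close> by simp
    have \<theta>: "0 \<le> \<theta>" "\<theta> \<le> 1" "\<theta> * (b j - b k) = \<delta>"
      using \<delta> pos \<open>a k \<le> a j\<close> k by (auto simp: \<theta>_def)
    define b' where "b' i = (1 - \<theta>) * b i + \<theta> * (b \<circ> Transposition.transpose j k) i" for i
    have b': "b' i = b i + (if i = j then - \<delta> else 0) + (if i = k then \<delta> else 0)" for i
      using \<theta>(3) j(1) by (auto simp: b'_def Transposition.transpose_def algebra_simps)
    have "F a \<le> F b'"
    proof (rule less.hyps)
      let ?D = "\<lambda>b. {i \<in> {..<n}. a i \<noteq> b i}"
      have "?D b' \<subseteq> ?D b" using j k by (auto simp: b' split: if_splits)
      moreover have "j \<in> ?D b" "k \<in> ?D b" using j k by auto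
      moreover have "j \<notin> ?D b' \<or> k \<notin> ?D b'" using j(1) by (auto simp: b' \<delta>_def min_def)
      ultimately have "?D b' \<subset> ?D b" by blast
      then show "card (?D b') < card (?D b)" by (intro psubset_card_mono) auto
    next
      fix p assume p: "p \<le> n"
      have sum_b': "(\<Sum>i<p. b' i) = (\<Sum>i<p. b i) + (if j < p then - \<delta> else 0) + (if k < p then \<delta> else 0)"
        by (simp add: b' sum.distrib)
      show "(\<Sum>i<p. a i) \<le> (\<Sum>i<p. b' i)"
      \<comment> \<open>Only prefixes that contain \<open>j\<close> but not \<open>k\<close> lose
        mass. They can afford it, because below \<open>k\<close> all differences
        \<open>b i - a i\<close> are nonnegative and the one at \<open>j\<close> is at least
        \<open>\<delta>\<close>.\<close>
      proof (cases "j < p \<and> p \<le> k")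
        case True
        have "b j - a j \<le> (\<Sum>i<p. b i - a i)"
          using True below by (intro member_le_sum) auto
        then show ?thesis using True \<delta>(2) by (simp add: sum_b' sum_subtractf)
      next
        case False
        then show ?thesis using less.prems[OF p] j(1) by (auto simp: sum_b')
      qed
    qed
    also have "F b' \<le> (1 - \<theta>) * F b + \<theta> * F (b \<circ> Transposition.transpose j k)"
      unfolding b'_def using \<theta> by (intro convex) auto
    also have "\<dots> \<le> (1 - \<theta>) * F b + \<theta> * F b"
      using swap[of j k b] j k \<theta> by (intro add_left_mono mult_left_mono) auto
    finally show ?thesis by (simp add: algebra_simps)
  qed
qed

text \<open>On a block \<open>a\<close> is constant and \<open>b\<close> decreases, so the
  difference of the partial sums is concave there and is nonnegative once it is so at both ends.
  Past the last block the difference can only grow.\<close>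

lemma partial_sums_le_of_blocks:
  fixes a b :: "nat \<Rightarrow> real"
  assumes q: "0 < q"
    and ends: "\<And>j. j \<le> J \<Longrightarrow> (\<Sum>i<j * q. a i) \<le> (\<Sum>i<j * q. b i)"
    and const: "\<And>i j. j < J \<Longrightarrow> j * q \<le> i \<Longrightarrow> i < Suc j * q \<Longrightarrow> a i = a (j * q)"
    and tail: "\<And>i. J * q \<le> i \<Longrightarrow> a i \<le> b i"
    and b_dec: "\<And>i j. i \<le> j \<Longrightarrow> b j \<le> b i"
  shows "(\<Sum>i<p. a i) \<le> (\<Sum>i<p. b i)"
proof -
  define D where "D p = (\<Sum>i<p. b i - a i)" for p
  have split: "D p' = D p + (\<Sum>i\<in>{p..<p'}. b i - a i)" if "p \<le> p'" for p p'
    unfolding D_def using sum.atLeastLessThan_concat[of 0 p p' "\<lambda>i. b i - a i"] that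
    by (simp add: lessThan_atLeast0)
  have ends': "0 \<le> D (j * q)" if "j \<le> J" for j
    using ends[OF that] by (simp add: D_def sum_subtractf)
  have "0 \<le> D p"
  proof (cases "J * q \<le> p")
    case True
    have "0 \<le> (\<Sum>i\<in>{J * q..<p}. b i - a i)" using tail by (intro sum_nonneg) auto
    then show ?thesis using split[OF True] ends'[of J] by simp
  next
    case False
    define j where "j = p div q"
    have lt: "p < Suc j * q" using q by (simp add: j_def) (metis add.commute dividend_less_div_times)
    have ge: "j * q \<le> p" by (simp add: j_def)
    have jJ: "j < J" using False q ge by (metis leI mult_le_mono1 order_trans)
    show ?thesis
    proof (rule ccontr)
      assume neg: "\<not> 0 \<le> D p"
      have "\<exists>i\<in>{j * q..<p}. b i - a i < 0"
      proof (rule ccontr)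
        assume "\<not> ?thesis"
        then have "0 \<le> (\<Sum>i\<in>{j * q..<p}. b i - a i)" by (intro sum_nonneg) (auto simp: not_less)
        then show False using split[OF ge] ends'[of j] jJ neg by simp
      qed
      then obtain i where i: "j * q \<le> i" "i < p" "b i < a i" by auto
      have "b i' - a i' \<le> 0" if "i' \<in> {p..<Suc j * q}" for i'
      proof -
        have "b i' \<le> b i" using that i by (intro b_dec) auto
        moreover have "a i' = a i" using const[OF jJ, of i] const[OF jJ, of i'] that i lt ge by auto
        ultimately show ?thesis using i by simp
      qed
      then have "(\<Sum>i'\<in>{p..<Suc j * q}. b i' - a i') \<le> 0" by (rule sum_nonpos)
      then have "D (Suc j * q) < 0" using split[of p "Suc j * q"] lt neg by simp
      then show False using ends'[of "Suc j"] jJ by simp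
    qed
  qed
  then show ?thesis by (simp add: D_def sum_subtractf)
qed

section \<open>Step functions on an equidistant grid\<close>

definition step_fun :: "real \<Rightarrow> nat \<Rightarrow> (nat \<Rightarrow> real) \<Rightarrow> real \<Rightarrow> ereal" where
  "step_fun h n b s = (if 0 \<le> s \<and> s < real n * h then ereal (b (nat \<lfloor>s / h\<rfloor>)) else 0)"

lemma step_index_less:
  assumes "0 < h" "0 \<le> s"
  shows "nat \<lfloor>s / h\<rfloor> < n \<longleftrightarrow> s < real n * h"
proof -
  have "nat \<lfloor>s / h\<rfloor> < n \<longleftrightarrow> \<lfloor>s / h\<rfloor> < int n" using assms by (auto simp: nat_less_iff)
  also have "\<dots> \<longleftrightarrow> s / h < real n" by (simp add: floor_less_iff)
  finally show ?thesis using assms by (simp add: pos_divide_less_eq)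
qed

text \<open>Stated for arbitrary \<open>ennreal\<close> values on the cells, so that it yields both
  the distribution functions and the primitives of step functions.\<close>

lemma nn_integral_step:
  fixes a :: "nat \<Rightarrow> ennreal"
  assumes h: "0 < h"
  shows "(\<integral>\<^sup>+ s. (if 0 \<le> s \<and> s < real n * h then a (nat \<lfloor>s / h\<rfloor>) else 0) \<partial>halfline)
    = (\<Sum>i<n. a i * ennreal h)"
proof -
  let ?I = "\<lambda>i. {real i * h..<(real i + 1) * h}"
  have sub: "?I i \<subseteq> {0..}" for i
  proof -
    have "0 \<le> real i * h" using h by simp
    then show ?thesis by auto
  qed
  have "(\<integral>\<^sup>+ s. (if 0 \<le> s \<and> s < real n * h then a (nat \<lfloor>s / h\<rfloor>) else 0) \<partial>halfline)
    = (\<integral>\<^sup>+ s. (\<Sum>i<n. a i * indicator (?I i) s) \<partial>halfline)"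
  proof (rule nn_integral_cong)
    fix s assume "s \<in> space halfline"
    then have s: "0 \<le> s" by simp
    have "indicator (?I i) s = (if i = nat \<lfloor>s / h\<rfloor> then 1 else 0 :: ennreal)" for i
    proof -
      have "s \<in> ?I i \<longleftrightarrow> real i \<le> s / h \<and> s / h < real i + 1"
        using h by (simp add: pos_le_divide_eq pos_divide_less_eq)
      also have "\<dots> \<longleftrightarrow> \<lfloor>s / h\<rfloor> = int i" by (simp add: floor_eq_iff)
      also have "\<dots> \<longleftrightarrow> i = nat \<lfloor>s / h\<rfloor>" using s h by (auto simp: nat_eq_iff2)
      finally show ?thesis by (simp add: indicator_def)
    qed
    then have "(\<Sum>i<n. a i * indicator (?I i) s) = (\<Sum>i<n. if i = nat \<lfloor>s / h\<rfloor> then a i else 0)"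
      by (intro sum.cong) auto
    also have "\<dots> = (if nat \<lfloor>s / h\<rfloor> < n then a (nat \<lfloor>s / h\<rfloor>) else 0)" by simp
    finally show "(if 0 \<le> s \<and> s < real n * h then a (nat \<lfloor>s / h\<rfloor>) else 0) = (\<Sum>i<n. a i * indicator (?I i) s)"
      using s by (simp add: step_index_less[OF h])
  qed
  also have "\<dots> = (\<Sum>i<n. \<integral>\<^sup>+ s. a i * indicator (?I i) s \<partial>halfline)"
  proof (rule nn_integral_sum)
    fix i assume "i \<in> {..<n}"
    have [measurable]: "?I i \<in> sets halfline" using sub by (intro sets_halflineI) auto
    show "(\<lambda>s. a i * indicator (?I i) s) \<in> borel_measurable halfline" by measurable
  qed
  also have "\<dots> = (\<Sum>i<n. a i * ennreal h)"
  proof (rule sum.cong)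
    fix i
    have "?I i \<in> sets halfline" using sub by (intro sets_halflineI) auto
    moreover have "emeasure halfline (?I i) = ennreal h"
      using h by (subst emeasure_halfline_Ico) (auto simp: algebra_simps)
    ultimately show "(\<integral>\<^sup>+ s. a i * indicator (?I i) s \<partial>halfline) = a i * ennreal h"
      by (simp add: nn_integral_cmult_indicator)
  qed simp
  finally show ?thesis .
qed

lemma step_fun_L0: "step_fun h n b \<in> L0"
proof -
  have "step_fun h n b \<in> borel_measurable borel"
    unfolding step_fun_def[abs_def] by measurable
  then show ?thesis by (simp add: L0_def measurable_restrict_borel)
qed

lemma distr_fun_step_fun:
  assumes "0 < h" "0 \<le> c"
  shows "distr_fun (step_fun h n b) c = (\<Sum>i<n. (if c < \<bar>b i\<bar> then 1 else 0) * ennreal h)"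
proof -
  have "distr_fun (step_fun h n b) c
      = (\<integral>\<^sup>+ s. indicator {s \<in> {0..}. ereal c < \<bar>step_fun h n b s\<bar>} s \<partial>halfline)"
    using L0_abs_gt_sets[OF step_fun_L0] by (simp add: distr_fun_def)
  also have "\<dots> = (\<integral>\<^sup>+ s. (if 0 \<le> s \<and> s < real n * h then
      (\<lambda>i. if c < \<bar>b i\<bar> then 1 else 0) (nat \<lfloor>s / h\<rfloor>) else 0) \<partial>halfline)"
    using assms(2) by (intro nn_integral_cong) (auto simp: step_fun_def indicator_def)
  finally show ?thesis using nn_integral_step[OF assms(1)] by simp
qed

text \<open>The distribution function is a sum over cells of equal length. This is how symmetry of
  the space provides invariance under transposition of coefficients.\<close>

lemma distr_fun_step_fun_permute:
  assumes "0 < h" "bij_betw \<pi> {..<n} {..<n}"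
  shows "distr_fun (step_fun h n (b \<circ> \<pi>)) = distr_fun (step_fun h n b)"
proof (rule distr_fun_eqI)
  fix c :: real assume "0 \<le> c"
  then show "distr_fun (step_fun h n (b \<circ> \<pi>)) c = distr_fun (step_fun h n b) c"
    using sum.reindex_bij_betw[OF assms(2), of "\<lambda>i. (if c < \<bar>b i\<bar> then 1 else 0) * ennreal h"]
    by (simp add: distr_fun_step_fun assms(1))
qed

lemma AE_halfline_neq: "AE s in halfline. s \<noteq> t"
proof (rule AE_I')
  show "{t} \<inter> {0..} \<in> null_sets halfline"
    by (cases "0 \<le> t") (auto simp: emeasure_halfline_borel intro!: null_setsI sets_halflineI)
qed auto

text \<open>The endpoint is null; the half-open form fits the half-open cells of the grid.\<close>

lemma prim_Ico: "prim f t = (\<integral>\<^sup>+ s \<in> {0..<t}. e2ennreal (f s) \<partial>halfline)"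
  unfolding prim_def using AE_halfline_neq[of t]
  by (intro nn_integral_cong_AE) (auto simp: indicator_def)

lemma prim_step_fun:
  assumes "0 < h" "p \<le> n"
  shows "prim (step_fun h n b) (real p * h) = (\<Sum>i<p. ennreal (b i) * ennreal h)"
proof -
  have le: "real p * h \<le> real n * h" using assms by simp
  have "prim (step_fun h n b) (real p * h)
      = (\<integral>\<^sup>+ s. (if 0 \<le> s \<and> s < real p * h then ennreal (b (nat \<lfloor>s / h\<rfloor>)) else 0) \<partial>halfline)"
    unfolding prim_Ico using le
    by (intro nn_integral_cong) (auto simp: step_fun_def indicator_def)
  then show ?thesis using nn_integral_step[OF assms(1), of p "\<lambda>i. ennreal (b i)"] by simp
qed

section \<open>Dyadic approximation of decreasing functions from below\<close>

definition dyadic_coeff :: "nat \<Rightarrow> (real \<Rightarrow> ereal) \<Rightarrow> nat \<Rightarrow> real" where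
  "dyadic_coeff k f i = real_of_ereal (min (f ((real i + 1) / 2 ^ k)) (ereal (real k)))"

text \<open>The \<open>4 ^ k\<close> cells of length \<open>1 / 2 ^ k\<close> fill
  \<open>[0, 2 ^ k)\<close>. Sampling at right endpoints keeps the step function below a decreasing
  \<open>f\<close>, and the cap \<open>k\<close> keeps the coefficients real where \<open>f\<close>
  is infinite.\<close>

definition dyadic_approx :: "nat \<Rightarrow> (real \<Rightarrow> ereal) \<Rightarrow> real \<Rightarrow> ereal" where
  "dyadic_approx k f = step_fun (1 / 2 ^ k) (4 ^ k) (dyadic_coeff k f)"

context
  fixes f :: "real \<Rightarrow> ereal"
  assumes f: "decreasing_rcont f"
begin

lemma ereal_dyadic_coeff: "ereal (dyadic_coeff k f i) = min (f ((real i + 1) / 2 ^ k)) (ereal (real k))"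
  using decreasing_rcontD(1)[OF f] unfolding dyadic_coeff_def
  by (intro ereal_real') (auto simp: min_def)

lemma dyadic_coeff_nonneg: "0 \<le> dyadic_coeff k f i"
proof -
  have "0 \<le> ereal (dyadic_coeff k f i)"
    unfolding ereal_dyadic_coeff using decreasing_rcontD(1)[OF f] by simp
  then show ?thesis by simp
qed

lemma dyadic_coeff_antimono: "i \<le> j \<Longrightarrow> dyadic_coeff k f j \<le> dyadic_coeff k f i"
proof -
  assume "i \<le> j"
  then have "(real i + 1) / 2 ^ k \<le> (real j + 1) / 2 ^ k" by (intro divide_right_mono) auto
  then have "ereal (dyadic_coeff k f j) \<le> ereal (dyadic_coeff k f i)"
    unfolding ereal_dyadic_coeff by (intro min.mono decreasing_rcontD(2)[OF f]) auto
  then show ?thesis by simp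
qed

lemma dyadic_approx_eq:
  assumes "0 \<le> s"
  shows "dyadic_approx k f s =
    (if s < 2 ^ k then min (f ((\<lfloor>s * 2 ^ k\<rfloor> + 1) / 2 ^ k)) (ereal (real k)) else 0)"
proof -
  have 4: "(4::real) ^ k = 2 ^ k * 2 ^ k" by (simp add: power_mult_distrib[symmetric])
  have "real (nat \<lfloor>s * 2 ^ k\<rfloor>) = \<lfloor>s * 2 ^ k\<rfloor>" using assms by simp
  then show ?thesis
    using assms unfolding dyadic_approx_def step_fun_def ereal_dyadic_coeff by (simp add: 4)
qed

lemma dyadic_approx_nonneg: "0 \<le> dyadic_approx k f s"
  unfolding dyadic_approx_def step_fun_def using dyadic_coeff_nonneg by simp

lemma dyadic_endpoint_gt: "s < (\<lfloor>s * 2 ^ k\<rfloor> + 1) / (2 ^ k :: real)"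
  by (simp add: pos_less_divide_eq)

lemma dyadic_approx_le:
  assumes "0 \<le> s" shows "dyadic_approx k f s \<le> f s"
  using assms decreasing_rcontD(1)[OF f]
    min.coboundedI1[OF decreasing_rcontD(2)[OF f less_imp_le[OF dyadic_endpoint_gt[of s k]]]]
  by (simp add: dyadic_approx_eq)

lemma dyadic_approx_incseq:
  assumes s: "0 \<le> s" shows "incseq (\<lambda>k. dyadic_approx k f s)"
proof (rule incseq_SucI)
  fix k
  show "dyadic_approx k f s \<le> dyadic_approx (Suc k) f s"
  proof (cases "s < 2 ^ k")
    case True
    then have "s < 2 ^ Suc k" by (rule less_le_trans) simp
    \<comment> \<open>The right endpoint of the refined cell around \<open>s\<close> does not exceed
      that of the old cell, so the sampled value can only grow.\<close>
    have "\<lfloor>s * 2 ^ Suc k\<rfloor> + 1 \<le> 2 * (\<lfloor>s * 2 ^ k\<rfloor> + 1)"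
    proof -
      have "s * 2 ^ Suc k < of_int (2 * (\<lfloor>s * 2 ^ k\<rfloor> + 1))"
        using floor_correct[of "s * 2 ^ k"] by (simp add: algebra_simps)
      then show ?thesis by (simp only: floor_less_iff[symmetric])
    qed
    then have "(\<lfloor>s * 2 ^ Suc k\<rfloor> + 1) / 2 ^ Suc k \<le> real_of_int (2 * (\<lfloor>s * 2 ^ k\<rfloor> + 1)) / 2 ^ Suc k"
      by (intro divide_right_mono) (simp_all only: of_int_le_iff, simp_all)
    also have "\<dots> = (\<lfloor>s * 2 ^ k\<rfloor> + 1) / 2 ^ k" by (simp add: field_simps)
    finally have "min (f ((\<lfloor>s * 2 ^ k\<rfloor> + 1) / 2 ^ k)) (ereal (real k))
        \<le> min (f ((\<lfloor>s * 2 ^ Suc k\<rfloor> + 1) / 2 ^ Suc k)) (ereal (real (Suc k)))"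
      by (intro min.mono decreasing_rcontD(2)[OF f]) auto
    then show ?thesis
      using True \<open>s < 2 ^ Suc k\<close> unfolding dyadic_approx_eq[OF s] by (simp only: if_True)
  next
    case False
    then show ?thesis using s dyadic_approx_nonneg[of "Suc k" s] by (simp add: dyadic_approx_eq[OF s, of k])
  qed
qed

lemma SUP_dyadic_approx:
  assumes s: "0 \<le> s" shows "(SUP k. dyadic_approx k f s) = f s"
proof (rule antisym)
  show "(SUP k. dyadic_approx k f s) \<le> f s" by (intro SUP_least dyadic_approx_le s)
next
  show "f s \<le> (SUP k. dyadic_approx k f s)"
  proof (rule dense_le)
    fix y assume "y < f s"
    then obtain c where c: "y < ereal c" "ereal c < f s" using ereal_dense2 by blast
    then obtain t where t: "s < t" "ereal c < f t" using decreasing_rcontD(3)[OF f] by blast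
    \<comment> \<open>Three demands on the level: cells short enough for the right endpoint to stay
      below \<open>t\<close>, a grid reaching past \<open>s\<close>, and a cap above
      \<open>c\<close>.\<close>
    obtain k1 where k1: "(1/2) ^ k1 < t - s"
      using real_arch_pow_inv[of "t - s" "1/2"] t by auto
    obtain k2 :: nat where k2: "s < real k2" using reals_Archimedean2 by blast
    obtain k3 :: nat where k3: "c < real k3" using reals_Archimedean2 by blast
    define k where "k = k1 + k2 + k3"
    have "(1/2) ^ k \<le> (1/2::real) ^ k1" by (rule power_decreasing) (auto simp: k_def)
    with k1 have "1 / 2 ^ k < t - s" by (simp add: power_one_over)
    then have "s * 2 ^ k + 1 < t * 2 ^ k" by (simp add: field_simps)
    then have "\<lfloor>s * 2 ^ k\<rfloor> + 1 \<le> t * 2 ^ k"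
      using of_int_floor_le[of "s * 2 ^ k"] by linarith
    then have "(\<lfloor>s * 2 ^ k\<rfloor> + 1) / 2 ^ k \<le> t"
      by (simp add: pos_divide_le_eq)
    then have "ereal c < f ((\<lfloor>s * 2 ^ k\<rfloor> + 1) / 2 ^ k)"
      using t(2) decreasing_rcontD(2)[OF f] less_le_trans by blast
    moreover have "s < 2 ^ k"
    proof -
      have "real k2 \<le> real k" by (simp add: k_def)
      also have "real k < 2 ^ k" by (rule of_nat_less_two_power)
      finally show ?thesis using k2 by linarith
    qed
    moreover have "c < real k" using k3 by (simp add: k_def)
    ultimately have "ereal c < dyadic_approx k f s" using s by (simp add: dyadic_approx_eq)
    then show "y \<le> (SUP k. dyadic_approx k f s)"
      using c(1) by (intro SUP_upper2[of k]) auto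
  qed
qed

lemma dyadic_approx_tendsto: "0 \<le> s \<Longrightarrow> (\<lambda>k. dyadic_approx k f s) \<longlonglongrightarrow> f s"
  using LIMSEQ_SUP[OF dyadic_approx_incseq] SUP_dyadic_approx by simp

lemma dyadic_approx_L0: "dyadic_approx k f \<in> L0"
  unfolding dyadic_approx_def by (rule step_fun_L0)

lemma prim_incseq_dyadic_approx: "incseq (\<lambda>k. prim (dyadic_approx k f) t)"
  by (intro incseq_SucI prim_mono) (rule incseq_SucD[OF dyadic_approx_incseq])

lemma SUP_prim_dyadic_approx: "(SUP k. prim (dyadic_approx k f) t) = prim f t"
proof -
  let ?g = "\<lambda>k s. e2ennreal (dyadic_approx k f s) * indicator {0..t} s"
  have "(\<integral>\<^sup>+ s. (SUP k. ?g k s) \<partial>halfline) = (SUP k. integral\<^sup>N halfline (?g k))"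
  proof (rule nn_integral_monotone_convergence_SUP)
    show "incseq ?g"
      using incseq_SucD[OF dyadic_approx_incseq]
      by (intro incseq_SucI le_funI) (auto simp: indicator_def intro!: e2ennreal_mono)
    show "?g k \<in> borel_measurable halfline" for k
    proof -
      have [measurable]: "dyadic_approx k f \<in> borel_measurable halfline" "{0..t} \<in> sets halfline"
        using dyadic_approx_L0 by (auto simp: L0_def intro: sets_halflineI)
      show ?thesis by measurable
    qed
  qed
  moreover have "(SUP k. ?g k s) = e2ennreal (f s) * indicator {0..t} s" if "s \<in> space halfline" for s
  proof -
    have s: "0 \<le> s" using that by simp
    have "(\<lambda>k. e2ennreal (dyadic_approx k f s)) \<longlonglongrightarrow> e2ennreal (f s)"
      using continuous_at_e2ennreal dyadic_approx_tendsto[OF s] by (rule isCont_tendsto_compose)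
    moreover have "incseq (\<lambda>k. e2ennreal (dyadic_approx k f s))"
      using dyadic_approx_incseq[OF s] by (auto simp: incseq_def intro: e2ennreal_mono)
    ultimately have "(SUP k. e2ennreal (dyadic_approx k f s)) = e2ennreal (f s)"
      using LIMSEQ_SUP LIMSEQ_unique by blast
    then show ?thesis by (auto simp: indicator_def)
  qed
  ultimately show ?thesis
    unfolding prim_def by (metis (no_types, lifting) nn_integral_cong)
qed

end

section \<open>The norm of a symmetric space\<close>

lemma L0_indicator: "A \<in> sets halfline \<Longrightarrow> indicator A \<in> L0"
  unfolding L0_def by (rule borel_measurable_indicator)

context banach_function_space
begin

lemma norm_cong_abs_AE:
  assumes "x \<in> E" "y \<in> L0" "AE t in halfline. \<bar>y t\<bar> = \<bar>x t\<bar>"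
  shows "y \<in> E" "N y = N x"
proof -
  have "AE t in halfline. \<bar>y t\<bar> \<le> \<bar>x t\<bar>" using assms(3) by eventually_elim simp
  from ideal[OF assms(2,1) this] have y: "y \<in> E" "N y \<le> N x" by auto
  have "AE t in halfline. \<bar>x t\<bar> \<le> \<bar>y t\<bar>" using assms(3) by eventually_elim simp
  from ideal[OF measurable[OF assms(1)] y(1) this] have "N x \<le> N y" by simp
  with y show "y \<in> E" "N y = N x" by auto
qed

lemma abs_mem:
  assumes "x \<in> E" shows "(\<lambda>t. \<bar>x t\<bar>) \<in> E" "N (\<lambda>t. \<bar>x t\<bar>) = N x"
proof -
  have "(\<lambda>t. \<bar>x t\<bar>) \<in> L0" using measurable[OF assms] by (simp add: L0_def)
  then show "(\<lambda>t. \<bar>x t\<bar>) \<in> E" "N (\<lambda>t. \<bar>x t\<bar>) = N x"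
    by (rule norm_cong_abs_AE[OF assms], simp)+
qed

text \<open>The triangle inequality combined with the ideal property: an a.e. bound by a sum of
  moduli suffices, and \<open>f\<close> itself need not be decomposed.\<close>

lemma norm_le_add:
  assumes "f \<in> L0" "g \<in> E" "h \<in> E" "AE t in halfline. \<bar>f t\<bar> \<le> \<bar>g t\<bar> + \<bar>h t\<bar>"
  shows "f \<in> E" "N f \<le> N g + N h"
proof -
  let ?s = "\<lambda>t. \<bar>g t\<bar> + \<bar>h t\<bar>"
  have s: "?s \<in> E" by (rule add[OF abs_mem(1)[OF assms(2)] abs_mem(1)[OF assms(3)]])
  have "\<bar>?s t\<bar> = ?s t" for t by simp
  then have "AE t in halfline. \<bar>f t\<bar> \<le> \<bar>?s t\<bar>" using assms(4) by (simp only:)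
  then have "f \<in> E \<and> N f \<le> N ?s" by (rule ideal[OF assms(1) s])
  moreover have "N ?s \<le> N g + N h"
    using norm_triangle[OF abs_mem(1)[OF assms(2)] abs_mem(1)[OF assms(3)]]
    by (simp only: abs_mem(2)[OF assms(2)] abs_mem(2)[OF assms(3)])
  ultimately show "f \<in> E" "N f \<le> N g + N h" by auto
qed

lemma norm_zero_AE:
  assumes "f \<in> L0" "AE t in halfline. f t = 0" shows "f \<in> E" "N f = 0"
proof -
  obtain w where w: "w \<in> E" using strictly_positive by blast
  have "AE t in halfline. \<bar>f t\<bar> \<le> \<bar>w t\<bar>" using assms(2) by eventually_elim simp
  from ideal[OF assms(1) w this] show "f \<in> E" by simp
  then show "N f = 0" using norm_eq_0 assms(2) by simp
qed

lemma cmult_indicator_mem: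
  assumes "indicator A \<in> E"
  shows "(\<lambda>t. ereal c * indicator A t) \<in> E" "N (\<lambda>t. ereal c * indicator A t) = \<bar>c\<bar> * N (indicator A)"
  by (rule scale[OF assms], rule norm_scale[OF assms])

end

section \<open>Indicators and the fundamental function\<close>

lemma distr_fun_indicator_cong:
  assumes "A \<in> sets halfline" "B \<in> sets halfline" "emeasure halfline A = emeasure halfline B"
  shows "distr_fun (indicator A) = distr_fun (indicator B)"
proof (rule distr_fun_eqI)
  have sub: "C \<subseteq> {0..}" if "C \<in> sets halfline" for C using sets.sets_into_space[OF that] by simp
  have *: "distr_fun (indicator C) c = (if c < 1 then emeasure halfline C else 0)"
    if "C \<in> sets halfline" "0 \<le> c" for C c
  proof -
    have "{s \<in> {0..}. ereal c < \<bar>indicator C s\<bar>} = (if c < 1 then C else {})"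
      using sub[OF that(1)] that(2) by (auto simp: indicator_def one_ereal_def split: if_splits)
    then show ?thesis by (simp add: distr_fun_def)
  qed
  fix c :: real assume "0 \<le> c"
  then show "distr_fun (indicator A) c = distr_fun (indicator B) c" using assms by (simp add: *)
qed

context symmetric_space
begin

lemma indicator_cong_emeasure:
  assumes "A \<in> sets halfline" "B \<in> sets halfline" "emeasure halfline B = emeasure halfline A"
    and "indicator A \<in> E"
  shows "indicator B \<in> E" "N (indicator B) = N (indicator A)"
  using symmetric[OF L0_indicator[OF assms(2)] assms(4) distr_fun_indicator_cong[OF assms(2,1,3)]] by auto

text \<open>A strictly positive \<open>w\<close> in \<open>E\<close> exceeds some
  \<open>1 / (n + 1)\<close> on a non-null part of \<open>[0, n)\<close>, as otherwise it would fail
  to be positive a.e. on \<open>[0, 1)\<close>. There the indicator is dominated by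
  \<open>(n + 1) * w\<close>.\<close>

lemma ex_indicator_mem:
  "\<exists>A a. A \<in> sets halfline \<and> 0 < a \<and> emeasure halfline A = ennreal a \<and> indicator A \<in> E"
proof -
  obtain w where w: "w \<in> E" "AE t in halfline. 0 < w t" using strictly_positive by blast
  have [measurable]: "w \<in> borel_measurable halfline" using measurable[OF w(1)] by (simp add: L0_def)
  let ?A = "\<lambda>n::nat. {t \<in> space halfline. t < real n \<and> ereal (1 / real (Suc n)) < w t}"
  have sets: "?A n \<in> sets halfline" for n
  proof -
    have [measurable]: "{t \<in> space halfline. t < real n} \<in> sets halfline" by (rule sets_halflineI) auto
    show ?thesis by measurable
  qed
  have "\<exists>n. emeasure halfline (?A n) \<noteq> 0"
  proof (rule ccontr)
    assume "\<not> ?thesis"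
    then have "(\<Union>n. ?A n) \<in> null_sets halfline" using sets by (intro null_sets_UN) auto
    then have "AE t in halfline. t \<notin> (\<Union>n. ?A n)" by (rule AE_not_in)
    then have "AE t in halfline. \<not> t \<in> {0..<1}"
      using w(2) AE_space
    proof eventually_elim
      case (elim t)
      from elim(2) obtain r where r: "0 < ereal r" "ereal r < w t" using ereal_dense2 by blast
      obtain n1 where n1: "inverse (real (Suc n1)) < r" using reals_Archimedean r by auto
      obtain n2 where n2: "t < real n2" using reals_Archimedean2 by blast
      have "1 / real (Suc (n1 + n2)) \<le> 1 / real (Suc n1)" by (intro divide_left_mono) auto
      also have "\<dots> < r" using n1 by (simp add: inverse_eq_divide)
      finally have "ereal (1 / real (Suc (n1 + n2))) < ereal r" by simp
      then have "ereal (1 / real (Suc (n1 + n2))) < w t" using r(2) by (rule less_trans)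
      then have "t \<in> ?A (n1 + n2)" using n2 elim(3) by auto
      then show ?case using elim(1) by blast
    qed
    from AE_halfline_ex_Ico[OF this, of 0 1] show False by auto
  qed
  then obtain n where n: "emeasure halfline (?A n) \<noteq> 0" by blast
  have "emeasure halfline (?A n) \<le> emeasure halfline {0..<real n}"
    by (rule emeasure_mono) (auto intro: sets_halflineI)
  then have "emeasure halfline (?A n) \<le> ennreal (real n)" by (simp add: emeasure_halfline_Ico)
  then have "emeasure halfline (?A n) \<noteq> \<infinity>" by (auto simp: top_unique)
  then obtain a where a: "emeasure halfline (?A n) = ennreal a" "0 < a"
    using n by (cases "emeasure halfline (?A n)") (auto simp: less_le)
  have "indicator (?A n) \<in> E"
  proof -
    have "\<bar>indicator (?A n) t\<bar> \<le> \<bar>ereal (real (Suc n)) * w t\<bar>" for t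
    proof (cases "t \<in> ?A n")
      case True
      then have "ereal (1 / real (Suc n)) < w t" by simp
      then have "ereal (real (Suc n)) * ereal (1 / real (Suc n)) \<le> ereal (real (Suc n)) * w t"
        by (intro ereal_mult_left_mono) auto
      then have "1 \<le> ereal (real (Suc n)) * w t" by (simp add: one_ereal_def)
      moreover from this have "0 \<le> ereal (real (Suc n)) * w t" by (rule order_trans[rotated]) simp
      ultimately show ?thesis using True abs_ereal_ge0 by (simp del: of_nat_Suc)
    qed simp
    then show ?thesis using ideal[OF L0_indicator[OF sets] scale[OF w(1)]] by blast
  qed
  with a sets show ?thesis by blast
qed

text \<open>By symmetry every interval of length \<open>a\<close> has its indicator in
  \<open>E\<close>; finitely many adjacent ones cover \<open>[0, t)\<close>.\<close>

lemma indicator_Ico_mem: "indicator {0..<t} \<in> E"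
proof -
  obtain A a where A: "A \<in> sets halfline" "0 < a" "emeasure halfline A = ennreal a" "indicator A \<in> E"
    using ex_indicator_mem by blast
  have "indicator {0..<real n * a} \<in> E" for n
  proof (induction n)
    case 0
    show ?case using norm_zero_AE(1)[of "\<lambda>_. 0"] by (simp add: L0_def indicator_def)
  next
    case (Suc n)
    have na: "0 \<le> real n * a" "real n * a \<le> real (Suc n) * a" using A(2) by (simp_all add: algebra_simps)
    have "real (Suc n) * a - real n * a = a" by (simp add: algebra_simps)
    then have "emeasure halfline {real n * a..<real (Suc n) * a} = emeasure halfline A"
      using na by (simp only: emeasure_halfline_Ico A(3))
    moreover have "{real n * a..<real (Suc n) * a} \<in> sets halfline"
      using na by (intro sets_halflineI) auto
    ultimately have "indicator {real n * a..<real (Suc n) * a} \<in> E"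
      using indicator_cong_emeasure(1)[OF A(1) _ _ A(4)] by simp
    from Suc.IH this have "(\<lambda>t. indicator {0..<real n * a} t + indicator {real n * a..<real (Suc n) * a} t :: ereal) \<in> E"
      by (rule add)
    moreover have "(\<lambda>t. indicator {0..<real n * a} t + indicator {real n * a..<real (Suc n) * a} t :: ereal)
        = indicator {0..<real (Suc n) * a}"
      using na by (auto simp: fun_eq_iff indicator_def simp del: of_nat_Suc)
    ultimately show ?case by simp
  qed
  moreover obtain n :: nat where "t / a < real n" using reals_Archimedean2 by blast
  then have "t \<le> real n * a" using A(2) by (simp add: pos_divide_less_eq)
  then have "AE s in halfline. \<bar>indicator {0..<t} s :: ereal\<bar> \<le> \<bar>indicator {0..<real n * a} s\<bar>"
    by (auto simp: indicator_def)
  moreover have "indicator {0..<t} \<in> L0" by (intro L0_indicator sets_halflineI) auto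
  ultimately show ?thesis using ideal by blast
qed

lemma indicator_finite_mem:
  assumes "A \<in> sets halfline" "emeasure halfline A = ennreal a" "0 \<le> a"
  shows "indicator A \<in> E" "N (indicator A) = fundamental_fun N a"
proof -
  have Ico: "{0..<a} \<in> sets halfline" by (rule sets_halflineI) auto
  have Ioo: "{0<..<a} \<in> sets halfline" by (rule sets_halflineI) auto
  have *: "indicator B \<in> E \<and> N (indicator B) = N (indicator {0..<a})"
    if "B \<in> sets halfline" "emeasure halfline B = ennreal a" for B
  proof -
    have "emeasure halfline B = emeasure halfline {0..<a}"
      using that(2) assms(3) by (simp add: emeasure_halfline_Ico)
    from indicator_cong_emeasure[OF Ico that(1) this indicator_Ico_mem] show ?thesis by simp
  qed
  have "emeasure halfline {0<..<a} = ennreal a" using assms(3) by (simp add: emeasure_halfline_Ioo)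
  from *[OF assms(1,2)] *[OF Ioo this]
  show "indicator A \<in> E" "N (indicator A) = fundamental_fun N a"
    unfolding fundamental_fun_def by simp_all
qed

lemma norm_indicator_Ico: "0 \<le> a \<Longrightarrow> N (indicator {0..<a}) = fundamental_fun N a"
  by (rule indicator_finite_mem(2)[OF sets_halflineI]) (auto simp: emeasure_halfline_Ico)

lemma fundamental_fun_nonneg: "0 \<le> fundamental_fun N a"
proof (cases "0 \<le> a")
  case True
  then show ?thesis using norm_nonneg[OF indicator_Ico_mem] by (simp flip: norm_indicator_Ico)
next
  case False
  then have "{0<..<a} = {0..<a}" by auto
  then show ?thesis unfolding fundamental_fun_def using norm_nonneg[OF indicator_Ico_mem] by simp
qed

lemma fundamental_fun_mono:
  assumes "0 \<le> a" "a \<le> b" shows "fundamental_fun N a \<le> fundamental_fun N b"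
proof -
  have "N (indicator {0..<a}) \<le> N (indicator {0..<b})"
    using assms by (intro ideal[OF measurable[OF indicator_Ico_mem] indicator_Ico_mem, THEN conjunct2] AE_I2)
      (simp add: indicator_def)
  then show ?thesis using assms by (simp add: norm_indicator_Ico)
qed

lemma bounded_support_mem:
  assumes "f \<in> L0" "\<And>s. 0 \<le> s \<Longrightarrow> \<bar>f s\<bar> \<le> ereal M * indicator {0..<T} s"
  shows "f \<in> E" "N f \<le> \<bar>M\<bar> * N (indicator {0..<T})"
proof -
  have "\<bar>f s\<bar> \<le> \<bar>ereal M * indicator {0..<T} s\<bar>" if "0 \<le> s" for s
    using assms(2)[OF that] by (rule order_trans) (auto simp: indicator_def)
  then have "AE s in halfline. \<bar>f s\<bar> \<le> \<bar>ereal M * indicator {0..<T} s\<bar>"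
    by (intro AE_I2) simp
  from ideal[OF assms(1) cmult_indicator_mem(1)[OF indicator_Ico_mem] this]
  show "f \<in> E" "N f \<le> \<bar>M\<bar> * N (indicator {0..<T})"
    by (simp_all only: cmult_indicator_mem(2)[OF indicator_Ico_mem])
qed

section \<open>Norms of step functions\<close>

lemma step_fun_mem: assumes "0 < h" shows "step_fun h n b \<in> E"
proof (rule bounded_support_mem(1)[OF step_fun_L0])
  fix s :: real assume s: "0 \<le> s"
  let ?M = "\<Sum>i<n. \<bar>b i\<bar>"
  show "\<bar>step_fun h n b s\<bar> \<le> ereal ?M * indicator {0..<real n * h} s"
  proof (cases "s < real n * h")
    case True
    then have "nat \<lfloor>s / h\<rfloor> < n" using step_index_less[OF assms s] by simp
    then have "\<bar>b (nat \<lfloor>s / h\<rfloor>)\<bar> \<le> ?M" by (intro member_le_sum) auto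
    then show ?thesis using True s by (simp add: step_fun_def)
  qed (simp add: step_fun_def)
qed

text \<open>The norm as a function of the coefficients satisfies the three requirements of the
  transfer argument: monotonicity by the ideal property, invariance under transpositions by
  symmetry, convexity by the triangle inequality.\<close>

lemma norm_step_fun_majorization:
  assumes h: "0 < h" and "\<And>i. i < n \<Longrightarrow> 0 \<le> a i" "\<And>i j. i \<le> j \<Longrightarrow> j < n \<Longrightarrow> a j \<le> a i"
    and "\<And>p. p \<le> n \<Longrightarrow> (\<Sum>i<p. a i) \<le> (\<Sum>i<p. b i)"
  shows "N (step_fun h n a) \<le> N (step_fun h n b)"
proof (rule weak_majorization_convex_symmetric_le[where n = n and F = "\<lambda>b. N (step_fun h n b)"])
  fix u v :: "nat \<Rightarrow> real" assume uv: "\<And>i. i < n \<Longrightarrow> 0 \<le> u i \<and> u i \<le> v i"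
  have "\<bar>step_fun h n u s\<bar> \<le> \<bar>step_fun h n v s\<bar>" for s
  proof (cases "0 \<le> s \<and> s < real n * h")
    case True
    then have "nat \<lfloor>s / h\<rfloor> < n" using step_index_less[OF h] by simp
    from uv[OF this] show ?thesis by (simp add: step_fun_def)
  qed (auto simp: step_fun_def)
  then show "N (step_fun h n u) \<le> N (step_fun h n v)"
    using ideal[OF step_fun_L0 step_fun_mem[OF h]] by blast
next
  fix u :: "nat \<Rightarrow> real" and j k assume "j < n" "k < n"
  then have "bij_betw (Transposition.transpose j k) {..<n} {..<n}"
    by (intro bij_betw_transpose_iff) simp
  from symmetric[OF step_fun_L0 step_fun_mem[OF h] distr_fun_step_fun_permute[OF h this]]
  show "N (step_fun h n (u \<circ> Transposition.transpose j k)) \<le> N (step_fun h n u)" by simp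
next
  fix u v :: "nat \<Rightarrow> real" and \<theta> :: real assume \<theta>: "0 \<le> \<theta>" "\<theta> \<le> 1"
  have "step_fun h n (\<lambda>i. (1 - \<theta>) * u i + \<theta> * v i)
      = (\<lambda>t. ereal (1 - \<theta>) * step_fun h n u t + ereal \<theta> * step_fun h n v t)"
    by (auto simp: step_fun_def fun_eq_iff)
  then have "N (step_fun h n (\<lambda>i. (1 - \<theta>) * u i + \<theta> * v i))
      \<le> N (\<lambda>t. ereal (1 - \<theta>) * step_fun h n u t) + N (\<lambda>t. ereal \<theta> * step_fun h n v t)"
    using norm_triangle[OF scale[OF step_fun_mem[OF h]] scale[OF step_fun_mem[OF h]]] by simp
  also have "\<dots> = (1 - \<theta>) * N (step_fun h n u) + \<theta> * N (step_fun h n v)"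
    using \<theta> by (simp add: norm_scale[OF step_fun_mem[OF h]])
  finally show "N (step_fun h n (\<lambda>i. (1 - \<theta>) * u i + \<theta> * v i))
      \<le> (1 - \<theta>) * N (step_fun h n u) + \<theta> * N (step_fun h n v)" .
qed (use assms in auto)

lemma dyadic_approx_mem: "dyadic_approx k f \<in> E"
  unfolding dyadic_approx_def by (rule step_fun_mem) simp

end

section \<open>Full symmetry\<close>

lemma dyadic_approx_index:
  assumes "0 \<le> s"
  shows "dyadic_approx k f s =
    ereal (if nat \<lfloor>s * 2 ^ k\<rfloor> < 4 ^ k then dyadic_coeff k f (nat \<lfloor>s * 2 ^ k\<rfloor>) else 0)"
  using assms step_index_less[of "1 / 2 ^ k" s "4 ^ k"]
  by (auto simp: dyadic_approx_def step_fun_def)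

text \<open>Cells of level \<open>m\<close> nest in cells of level \<open>k\<close>; used to rewrite
  a coarse step function on a finer grid.\<close>

lemma nat_floor_dyadic:
  assumes "k \<le> m" "0 \<le> (s::real)"
  shows "nat \<lfloor>s * 2 ^ m\<rfloor> div 2 ^ (m - k) = nat \<lfloor>s * 2 ^ k\<rfloor>"
proof -
  have "(2::real) ^ m = 2 ^ k * 2 ^ (m - k)" using assms(1) by (simp flip: power_add)
  then have "s * 2 ^ k = s * 2 ^ m / real_of_int (2 ^ (m - k))" by simp
  then have "\<lfloor>s * 2 ^ k\<rfloor> = \<lfloor>s * 2 ^ m\<rfloor> div 2 ^ (m - k)"
    by (simp only: floor_divide_real_eq_div[of "2 ^ (m - k)"] zero_le_power zero_le_numeral)
  then show ?thesis using assms(2) by (simp add: nat_div_distrib nat_power_eq)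
qed

locale fatou_symmetric_space = symmetric_space +
  assumes fatou: "fatou_property E N"
begin

text \<open>The factor \<open>z < 1\<close> leaves room at each of the finitely many coarse nodes,
  so the primitive of a single fine approximation of \<open>v\<close> dominates at all of them.
  Written on the fine grid, \<open>z * dyadic_approx k u\<close> is constant on blocks, hence the
  partial sums compare everywhere and the majorization of sequences applies.\<close>

lemma dyadic_approx_norm_le:
  assumes u: "decreasing_rcont u" and v: "decreasing_rcont v" "v \<in> E"
    and le: "\<And>t. 0 < t \<Longrightarrow> prim u t \<le> prim v t"
    and z: "0 < z" "z < 1"
  shows "z * N (dyadic_approx k u) \<le> N v"
proof -
  let ?c = "dyadic_coeff k u"
  have prim_u: "prim (dyadic_approx k u) (real j / 2 ^ k) = ennreal ((\<Sum>i<j. ?c i) / 2 ^ k)"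
    if "j \<le> 4 ^ k" for j
  proof -
    have "prim (dyadic_approx k u) (real j * (1 / 2 ^ k)) = (\<Sum>i<j. ennreal (?c i) * ennreal (1 / 2 ^ k))"
      unfolding dyadic_approx_def using that by (intro prim_step_fun) auto
    also have "\<dots> = (\<Sum>i<j. ennreal (?c i * (1 / 2 ^ k)))"
      by (intro sum.cong refl ennreal_mult[symmetric] dyadic_coeff_nonneg[OF u]) simp
    also have "\<dots> = ennreal (\<Sum>i<j. ?c i * (1 / 2 ^ k))"
      by (intro sum_ennreal mult_nonneg_nonneg dyadic_coeff_nonneg[OF u]) simp
    finally show ?thesis by (simp add: sum_divide_distrib)
  qed
  have "\<forall>\<^sub>F m in sequentially. \<forall>j\<in>{..4 ^ k}.
    ennreal z * prim (dyadic_approx k u) (real j / 2 ^ k) \<le> prim (dyadic_approx m v) (real j / 2 ^ k)"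
  proof (rule eventually_ball_finite)
    show "\<forall>j\<in>{..4 ^ k}. \<forall>\<^sub>F m in sequentially.
      ennreal z * prim (dyadic_approx k u) (real j / 2 ^ k) \<le> prim (dyadic_approx m v) (real j / 2 ^ k)"
    proof
      fix j :: nat assume "j \<in> {..4 ^ k}"
      then have j: "j \<le> 4 ^ k" by simp
      let ?t = "real j / 2 ^ k"
      define S where "S = (\<Sum>i<j. ?c i) / 2 ^ k"
      have P: "prim (dyadic_approx k u) ?t = ennreal S" using prim_u[OF j] by (simp add: S_def)
      show "\<forall>\<^sub>F m in sequentially.
        ennreal z * prim (dyadic_approx k u) ?t \<le> prim (dyadic_approx m v) ?t"
      proof (cases "S = 0")
        case True
        then show ?thesis by (simp add: P)
      next
        case False
        then have "j \<noteq> 0" by (cases "j = 0") (simp_all add: S_def)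
        then have t: "0 < ?t" by simp
        have "0 \<le> S" unfolding S_def by (intro divide_nonneg_nonneg sum_nonneg dyadic_coeff_nonneg[OF u]) simp
        with False have "0 < S" by simp
        \<comment> \<open>Strictness is what allows the supremum over \<open>m\<close> to be
          replaced by a finite level.\<close>
        then have "ennreal z * ennreal S < ennreal S"
          using z ennreal_lessI[of S "z * S"] by (simp add: ennreal_mult)
        also have "ennreal S \<le> prim u ?t"
          unfolding P[symmetric] by (intro prim_mono dyadic_approx_le[OF u])
        also have "\<dots> \<le> prim v ?t" by (rule le[OF t])
        also have "\<dots> = (SUP m. prim (dyadic_approx m v) ?t)"
          using SUP_prim_dyadic_approx[OF v(1)] by simp
        finally obtain m0 where m0: "ennreal z * ennreal S < prim (dyadic_approx m0 v) ?t"
          by (auto simp: less_SUP_iff)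
        show ?thesis
        proof (rule eventually_sequentiallyI[of m0])
          fix m assume "m0 \<le> m"
          then have "prim (dyadic_approx m0 v) ?t \<le> prim (dyadic_approx m v) ?t"
            by (rule incseqD[OF prim_incseq_dyadic_approx[OF v(1)]])
          with m0 show "ennreal z * prim (dyadic_approx k u) ?t \<le> prim (dyadic_approx m v) ?t"
            by (simp add: P)
        qed
      qed
    qed
  qed simp
  then obtain m0 where m0: "\<And>m. m0 \<le> m \<Longrightarrow> \<forall>j\<in>{..4 ^ k}.
    ennreal z * prim (dyadic_approx k u) (real j / 2 ^ k) \<le> prim (dyadic_approx m v) (real j / 2 ^ k)"
    unfolding eventually_sequentially by blast
  \<comment> \<open>At least \<open>k\<close>, so that each coarse cell consists of \<open>q\<close>
    fine ones.\<close>
  define m where "m = max m0 k"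
  have km: "k \<le> m" and m_ge: "m0 \<le> m" by (simp_all add: m_def)
  define q :: nat where "q = 2 ^ (m - k)"
  have q: "0 < q" by (simp add: q_def)
  have pow_m: "(2::real) ^ m = 2 ^ k * real q" using km by (simp add: q_def flip: power_add)
  have n_ge: "4 ^ k * q \<le> 4 ^ m"
  proof -
    have "(4::nat) ^ m = 4 ^ k * 4 ^ (m - k)" using km by (simp flip: power_add)
    moreover have "q \<le> 4 ^ (m - k)" unfolding q_def by (rule power_mono) auto
    ultimately show ?thesis by simp
  qed
  \<comment> \<open>The fine grid may reach beyond \<open>2 ^ k\<close>, where the coarse one ends;
    the coefficients are continued by \<open>0\<close>.\<close>
  define c' where "c' i = (if i < 4 ^ k then ?c i else 0)" for i
  have c'_nonneg: "0 \<le> c' i" for i using dyadic_coeff_nonneg[OF u] by (simp add: c'_def)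
  have c'_dec: "c' j \<le> c' i" if "i \<le> j" for i j
    using that dyadic_coeff_antimono[OF u that] dyadic_coeff_nonneg[OF u] by (simp add: c'_def)
  \<comment> \<open>The coefficients of \<open>z * dyadic_approx k u\<close> on the fine grid, each
    coarse value being repeated \<open>q\<close> times.\<close>
  define a where "a i = z * c' (i div q)" for i
  let ?b = "dyadic_coeff m v"
  have b_nonneg: "0 \<le> ?b i" for i by (rule dyadic_coeff_nonneg[OF v(1)])
  have block: "i div q = j" if "j * q \<le> i" "i < Suc j * q" for i j
    using that by (intro div_nat_eqI) (simp_all add: mult.commute)
  have ends: "(\<Sum>i<j * q. a i) \<le> (\<Sum>i<j * q. ?b i)" if j: "j \<le> 4 ^ k" for j
  proof -
    have jq: "j * q \<le> 4 ^ m" by (rule order_trans[OF mult_le_mono1[OF j] n_ge])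
    have t: "real j / 2 ^ k = real (j * q) * (1 / 2 ^ m)"
      using q by (simp add: pow_m)
    have "prim (dyadic_approx m v) (real j / 2 ^ k) = (\<Sum>i<j * q. ennreal (?b i) * ennreal (1 / 2 ^ m))"
      unfolding t unfolding dyadic_approx_def using jq by (intro prim_step_fun) auto
    also have "\<dots> = (\<Sum>i<j * q. ennreal (?b i * (1 / 2 ^ m)))"
      by (intro sum.cong refl ennreal_mult[symmetric] b_nonneg) simp
    also have "\<dots> = ennreal (\<Sum>i<j * q. ?b i * (1 / 2 ^ m))"
      by (intro sum_ennreal mult_nonneg_nonneg b_nonneg) simp
    also have "(\<Sum>i<j * q. ?b i * (1 / 2 ^ m)) = (\<Sum>i<j * q. ?b i) / 2 ^ m"
      by (simp add: sum_divide_distrib)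
    finally have prim_v: "prim (dyadic_approx m v) (real j / 2 ^ k) = ennreal ((\<Sum>i<j * q. ?b i) / 2 ^ m)" .
    have "ennreal (z * ((\<Sum>i<j. ?c i) / 2 ^ k)) = ennreal z * ennreal ((\<Sum>i<j. ?c i) / 2 ^ k)"
      using z by (intro ennreal_mult') simp
    also have "\<dots> \<le> ennreal ((\<Sum>i<j * q. ?b i) / 2 ^ m)"
      using m0[OF m_ge] j unfolding prim_u[OF j, symmetric] prim_v[symmetric] by blast
    finally have le': "z * ((\<Sum>i<j. ?c i) / 2 ^ k) \<le> (\<Sum>i<j * q. ?b i) / 2 ^ m"
      by (subst (asm) ennreal_le_iff) (intro divide_nonneg_nonneg sum_nonneg b_nonneg, simp)
    have "(\<Sum>i<j * q. a i) = (\<Sum>i'<j. \<Sum>i\<in>{i' * q..<i' * q + q}. a i)"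
      by (rule sum.nat_group[symmetric])
    also have "\<dots> = (\<Sum>i'<j. real q * (z * ?c i'))"
    proof (rule sum.cong)
      fix i' assume "i' \<in> {..<j}"
      then have "c' i' = ?c i'" using j by (simp add: c'_def)
      then have "(\<Sum>i\<in>{i' * q..<i' * q + q}. a i) = (\<Sum>i\<in>{i' * q..<i' * q + q}. z * ?c i')"
        by (intro sum.cong) (auto simp: a_def block)
      then show "(\<Sum>i\<in>{i' * q..<i' * q + q}. a i) = real q * (z * ?c i')" by simp
    qed simp
    also have "\<dots> = real q * (z * (\<Sum>i<j. ?c i))" by (simp add: sum_distrib_left)
    also have "\<dots> = 2 ^ m * (z * ((\<Sum>i<j. ?c i) / 2 ^ k))"
      by (simp add: pow_m)
    also have "\<dots> \<le> 2 ^ m * ((\<Sum>i<j * q. ?b i) / 2 ^ m)" using le' by (intro mult_left_mono) auto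
    finally show ?thesis by simp
  qed
  have sums: "(\<Sum>i<p. a i) \<le> (\<Sum>i<p. ?b i)" for p
  proof (rule partial_sums_le_of_blocks[OF q ends])
    fix i j assume "j * q \<le> i" "i < Suc j * q"
    then show "a i = a (j * q)" using q by (simp add: a_def block)
  next
    fix i assume "4 ^ k * q \<le> i"
    then have "4 ^ k \<le> i div q" using q by (simp add: less_eq_div_iff_mult_less_eq)
    then show "a i \<le> ?b i" using b_nonneg by (simp add: a_def c'_def)
  qed (auto intro: dyadic_coeff_antimono[OF v(1)])
  have "N (step_fun (1 / 2 ^ m) (4 ^ m) a) \<le> N (dyadic_approx m v)"
    unfolding dyadic_approx_def
  proof (rule norm_step_fun_majorization)
    show "0 \<le> a i" for i using z c'_nonneg by (simp add: a_def)
    show "a j \<le> a i" if "i \<le> j" for i j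
      unfolding a_def using z that by (intro mult_left_mono c'_dec div_le_mono) auto
  qed (use sums in auto)
  moreover have "step_fun (1 / 2 ^ m) (4 ^ m) a = (\<lambda>s. ereal z * dyadic_approx k u s)"
  proof
    fix s :: real
    show "step_fun (1 / 2 ^ m) (4 ^ m) a s = ereal z * dyadic_approx k u s"
    proof (cases "0 \<le> s")
      case True
      let ?i = "nat \<lfloor>s * 2 ^ m\<rfloor>"
      have div: "?i div q = nat \<lfloor>s * 2 ^ k\<rfloor>" using nat_floor_dyadic[OF km True] by (simp add: q_def)
      have rhs: "ereal z * dyadic_approx k u s = ereal (a ?i)"
        using dyadic_approx_index[OF True, of k u] by (simp add: a_def c'_def div)
      have lhs: "step_fun (1 / 2 ^ m) (4 ^ m) a s = ereal (if ?i < 4 ^ m then a ?i else 0)"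
        using True step_index_less[of "1 / 2 ^ m" s "4 ^ m"] by (auto simp: step_fun_def)
      have "a ?i = 0" if "\<not> ?i < 4 ^ m"
      proof -
        have "4 ^ k * q \<le> ?i" using that by (intro order_trans[OF n_ge]) (simp only: not_less)
        then have "4 ^ k \<le> ?i div q" using q by (simp add: less_eq_div_iff_mult_less_eq)
        then show ?thesis by (simp add: a_def c'_def)
      qed
      then show ?thesis unfolding lhs rhs by simp
    qed (simp add: dyadic_approx_def step_fun_def)
  qed
  moreover have "N (\<lambda>s. ereal z * dyadic_approx k u s) = z * N (dyadic_approx k u)"
    using z norm_scale[OF dyadic_approx_mem] by simp
  moreover have "N (dyadic_approx m v) \<le> N v"
  proof (rule ideal[THEN conjunct2, OF dyadic_approx_L0[OF v(1)] v(2)])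
    show "AE s in halfline. \<bar>dyadic_approx m v s\<bar> \<le> \<bar>v s\<bar>"
    proof (rule AE_I2)
      fix s assume "s \<in> space halfline"
      then show "\<bar>dyadic_approx m v s\<bar> \<le> \<bar>v s\<bar>"
        using dyadic_approx_le[OF v(1)] dyadic_approx_nonneg[OF v(1)] decreasing_rcontD(1)[OF v(1)] by simp
    qed
  qed
  ultimately show ?thesis by simp
qed

text \<open>Letting \<open>z\<close> tend to 1 bounds the norms of all dyadic approximations of
  \<open>u\<close> by \<open>N v\<close>. They increase to \<open>u\<close>, so the Fatou property
  gives both membership and the norm bound.\<close>

lemma decreasing_submaj_norm_le:
  assumes u: "decreasing_rcont u" and v: "decreasing_rcont v" "v \<in> E"
    and le: "\<And>t. 0 < t \<Longrightarrow> prim u t \<le> prim v t"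
  shows "u \<in> E" "N u \<le> N v"
proof -
  let ?X = "\<lambda>k. dyadic_approx k u"
  have bound: "N (?X k) \<le> N v" for k
    by (rule field_le_mult_one_interval) (rule dyadic_approx_norm_le[OF u v le])
  have "u \<in> E \<and> incseq (\<lambda>k. N (?X k)) \<and> (\<lambda>k. N (?X k)) \<longlonglongrightarrow> N u"
  proof (rule fatou[unfolded fatou_property_def, rule_format], intro conjI allI)
    show "?X k \<in> positive_cone E" for k
      using dyadic_approx_mem dyadic_approx_nonneg[OF u] by (simp add: positive_cone_def)
    show "bdd_above (range (\<lambda>k. N (?X k)))" using bound by (intro bdd_aboveI2)
    show "u \<in> L0" by (rule decreasing_rcont_L0[OF u])
    show "AE t in halfline. incseq (\<lambda>k. ?X k t) \<and> (\<lambda>k. ?X k t) \<longlonglongrightarrow> u t"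
    proof (intro AE_I2 conjI)
      fix t assume "t \<in> space halfline"
      then have "0 \<le> t" by simp
      then show "incseq (\<lambda>k. ?X k t)" "(\<lambda>k. ?X k t) \<longlonglongrightarrow> u t"
        by (rule dyadic_approx_incseq[OF u], rule dyadic_approx_tendsto[OF u])
    qed
  qed
  then show "u \<in> E" "N u \<le> N v" using bound LIMSEQ_le_const2[of _ "N u" "N v"] by blast+
qed

lemma rearr_mem:
  assumes "x \<in> E" shows "rearr x \<in> E" "N (rearr x) = N x"
  using symmetric[OF rearr_L0[OF measurable[OF assms]] assms distr_fun_rearr[OF measurable[OF assms]]]
  by simp_all

lemma mem_of_rearr_mem:
  assumes "x \<in> L0" "rearr x \<in> E" shows "x \<in> E" "N x = N (rearr x)"
  using symmetric[OF assms distr_fun_rearr[OF assms(1), symmetric]] by simp_all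

theorem submaj_norm_le:
  assumes "x \<in> L0" "y \<in> E" "submaj x y" shows "x \<in> E" "N x \<le> N y"
proof -
  have "rearr x \<in> E" "N (rearr x) \<le> N (rearr y)"
    using assms(3) unfolding submaj_iff
    by (blast intro: decreasing_submaj_norm_le[OF decreasing_rcont_rearr[OF assms(1)]
          decreasing_rcont_rearr[OF measurable[OF assms(2)]] rearr_mem(1)[OF assms(2)]])+
  with mem_of_rearr_mem[OF assms(1) this(1)] rearr_mem(2)[OF assms(2)]
  show "x \<in> E" "N x \<le> N y" by simp_all
qed

text \<open>Among functions obeying both constraints, \<open>M\<close> times the indicator of
  \<open>[0, \<tau>)\<close> is the largest for submajorization: its primitive is
  \<open>M * min t \<tau>\<close>, and each constraint accounts for one of the two bounds.\<close>

lemma norm_le_bounded_integrable: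
  assumes f: "f \<in> L0" and M: "0 \<le> M" and \<tau>: "0 \<le> \<tau>"
    and bound: "AE t in halfline. \<bar>f t\<bar> \<le> ereal M"
    and int: "(\<integral>\<^sup>+ t. e2ennreal \<bar>f t\<bar> \<partial>halfline) \<le> ennreal (M * \<tau>)"
  shows "f \<in> E" "N f \<le> M * fundamental_fun N \<tau>"
proof -
  \<comment> \<open>\<open>?v\<close> is extended to negative arguments so as to be decreasing on
    the whole line; \<open>?v'\<close> agrees with it on the half-line and has a known norm.\<close>
  let ?v = "\<lambda>t. ereal M * indicator {..<\<tau>} t :: ereal"
  let ?v' = "\<lambda>t. ereal M * indicator {0..<\<tau>} t :: ereal"
  have v: "decreasing_rcont ?v"
    unfolding decreasing_rcont_def
  proof (intro conjI allI impI)
    fix t c assume c: "ereal c < ?v t"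
    show "\<exists>t'>t. ereal c < ?v t'"
    proof (cases "t < \<tau>")
      case True
      then obtain t' where "t < t'" "t' < \<tau>" using dense by blast
      then show ?thesis using c True by (intro exI[of _ t']) auto
    next
      case False
      then show ?thesis using c by (intro exI[of _ "t + 1"]) auto
    qed
  qed (use M in \<open>auto simp: indicator_def\<close>)
  have v'E: "?v' \<in> E" "N ?v' = M * fundamental_fun N \<tau>"
    using cmult_indicator_mem[OF indicator_Ico_mem] M \<tau> by (simp_all add: norm_indicator_Ico)
  have "AE t in halfline. \<bar>?v t\<bar> = \<bar>?v' t\<bar>" by (intro AE_I2) (simp add: indicator_def)
  note vE = norm_cong_abs_AE[OF v'E(1) decreasing_rcont_L0[OF v] this]
  have "distr_fun f M \<le> distr_fun (\<lambda>_. ereal M) M"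
    using bound M by (intro distr_fun_mono) (auto simp: L0_def)
  also have "\<dots> = 0" using M by (simp add: distr_fun_def)
  finally have "distr_fun f M = 0" by simp
  then have rearr_le: "rearr f t \<le> ereal M" for t
    using rearr_gt_iff[OF f M, of t] by (simp add: not_less)
  have prim_v: "prim ?v t = ennreal (M * min t \<tau>)" if "0 < t" for t
  proof -
    have "prim ?v t = (\<integral>\<^sup>+ s. ennreal M * indicator {0..<min t \<tau>} s \<partial>halfline)"
      unfolding prim_Ico by (intro nn_integral_cong) (auto simp: indicator_def e2ennreal_neg)
    also have "\<dots> = ennreal M * emeasure halfline {0..<min t \<tau>}"
      by (rule nn_integral_cmult_indicator) (auto intro: sets_halflineI)
    finally show ?thesis using that \<tau> M by (simp add: emeasure_halfline_Ico ennreal_mult)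
  qed
  have prim_le: "prim (rearr f) t \<le> prim ?v t" if t: "0 < t" for t
  proof (cases "t \<le> \<tau>")
    case True
    have "prim (rearr f) t \<le> (\<integral>\<^sup>+ s. ennreal M * indicator {0..<t} s \<partial>halfline)"
      unfolding prim_Ico using e2ennreal_mono[OF rearr_le]
      by (intro nn_integral_mono) (auto simp: indicator_def)
    also have "\<dots> = ennreal M * emeasure halfline {0..<t}"
      by (rule nn_integral_cmult_indicator) (auto intro: sets_halflineI)
    finally show ?thesis using t True M by (simp add: prim_v emeasure_halfline_Ico ennreal_mult)
  next
    case False
    have "prim (rearr f) t \<le> (\<integral>\<^sup>+ s. e2ennreal \<bar>f s\<bar> \<partial>halfline)"
      using prim_le_integral[of "rearr f"] nn_integral_rearr[OF f] by simp
    also note int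
    finally show ?thesis using False t by (simp add: prim_v)
  qed
  note R = decreasing_submaj_norm_le[OF decreasing_rcont_rearr[OF f] v vE(1) prim_le]
  show "f \<in> E" "N f \<le> M * fundamental_fun N \<tau>"
    using mem_of_rearr_mem[OF f R(1)] R(2) unfolding vE(2) v'E(2) by simp_all
qed

end

section \<open>Truncation\<close>

definition cut :: "real \<Rightarrow> (real \<Rightarrow> ereal) \<Rightarrow> real \<Rightarrow> ereal" where
  "cut k f t = min \<bar>f t\<bar> (ereal k)"

definition excess :: "real \<Rightarrow> (real \<Rightarrow> ereal) \<Rightarrow> real \<Rightarrow> ereal" where
  "excess k f t = max 0 (\<bar>f t\<bar> - ereal k)"

lemma cut_L0: "f \<in> L0 \<Longrightarrow> cut k f \<in> L0"
  unfolding L0_def cut_def[abs_def] by simp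

lemma excess_L0: "f \<in> L0 \<Longrightarrow> excess k f \<in> L0"
  unfolding L0_def excess_def[abs_def] by simp

lemma cut_nonneg: "0 \<le> k \<Longrightarrow> 0 \<le> cut k f t"
  by (simp add: cut_def)

lemma excess_nonneg: "0 \<le> excess k f t"
  by (simp add: excess_def)

lemma cut_add_excess: "0 \<le> k \<Longrightarrow> cut k f t + excess k f t = \<bar>f t\<bar>"
  unfolding cut_def excess_def by (cases "f t") (auto simp: min_def max_def zero_ereal_def)

lemma excess_le: "0 \<le> k \<Longrightarrow> excess k f t \<le> \<bar>f t\<bar>"
  unfolding excess_def by (cases "f t") (auto simp: zero_ereal_def)

lemma excess_mono: "\<bar>f s\<bar> \<le> \<bar>g t\<bar> \<Longrightarrow> excess k f s \<le> excess k g t"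
  unfolding excess_def by (intro max.mono ereal_minus_mono) auto

lemma less_excess_iff: "0 \<le> c \<Longrightarrow> ereal c < excess k f t \<longleftrightarrow> ereal (c + k) < \<bar>f t\<bar>"
  unfolding excess_def by (cases "f t") (auto simp: zero_ereal_def less_max_iff_disj)

lemma less_cut_iff: "ereal c < cut k f t \<longleftrightarrow> c < k \<and> ereal c < \<bar>f t\<bar>"
  unfolding cut_def by auto

lemma distr_fun_excess: "0 \<le> c \<Longrightarrow> distr_fun (excess k f) c = distr_fun f (c + k)"
  unfolding distr_fun_def by (simp add: excess_nonneg less_excess_iff)

lemma distr_fun_excess_cong: "distr_fun f = distr_fun g \<Longrightarrow> distr_fun (excess k f) = distr_fun (excess k g)"
  by (rule distr_fun_eqI) (simp add: distr_fun_excess)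

lemma distr_fun_cut: "0 \<le> k \<Longrightarrow> distr_fun (cut k f) c = (if c < k then distr_fun f c else 0)"
  unfolding distr_fun_def by (auto simp: cut_nonneg less_cut_iff)

lemma distr_fun_cut_cong: "0 \<le> k \<Longrightarrow> distr_fun f = distr_fun g \<Longrightarrow> distr_fun (cut k f) = distr_fun (cut k g)"
  by (simp add: distr_fun_cut fun_eq_iff)

lemma decreasing_rcont_excess:
  assumes f: "decreasing_rcont f" shows "decreasing_rcont (excess k f)"
  unfolding decreasing_rcont_def
proof (intro conjI allI impI)
  have abs: "\<bar>f s\<bar> = f s" for s using decreasing_rcontD(1)[OF f] by simp
  fix s t :: real
  show "0 \<le> excess k f t" by (rule excess_nonneg)
  show "excess k f t \<le> excess k f s" if "s \<le> t"
    using decreasing_rcontD(2)[OF f that] by (intro excess_mono) (simp add: abs)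
  show "\<exists>t'>t. ereal c < excess k f t'" if c: "ereal c < excess k f t" for c
  proof (cases "0 \<le> c")
    case True
    then have "ereal (c + k) < f t" using c by (simp add: less_excess_iff abs)
    then obtain t' where "t < t'" "ereal (c + k) < f t'" using decreasing_rcontD(3)[OF f] by blast
    then show ?thesis using True by (auto simp: less_excess_iff abs)
  next
    case False
    then have "ereal c < excess k f (t + 1)" by (intro less_le_trans[OF _ excess_nonneg]) simp
    then show ?thesis by (intro exI[of _ "t + 1"]) simp
  qed
qed

lemma decreasing_rcont_cut:
  assumes f: "decreasing_rcont f" and k: "0 \<le> k" shows "decreasing_rcont (cut k f)"
  unfolding decreasing_rcont_def
proof (intro conjI allI impI)
  have abs: "\<bar>f s\<bar> = f s" for s using decreasing_rcontD(1)[OF f] by simp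
  fix s t :: real
  show "0 \<le> cut k f t" by (rule cut_nonneg[OF k])
  show "cut k f t \<le> cut k f s" if "s \<le> t"
    unfolding cut_def abs by (intro min.mono decreasing_rcontD(2)[OF f that] order_refl)
  show "\<exists>t'>t. ereal c < cut k f t'" if c: "ereal c < cut k f t" for c
  proof -
    have "c < k" "ereal c < f t" using c by (simp_all add: less_cut_iff abs)
    then obtain t' where "t < t'" "ereal c < f t'" using decreasing_rcontD(3)[OF f] by blast
    then show ?thesis using \<open>c < k\<close> by (auto simp: less_cut_iff abs)
  qed
qed

text \<open>Truncating \<open>rearr f\<close> keeps it decreasing and right continuous, and the
  result is equimeasurable with \<open>cut k f\<close>.\<close>

lemma rearr_cut:
  assumes "f \<in> L0" "0 \<le> k" "0 \<le> t" shows "rearr (cut k f) t = cut k (rearr f) t"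
proof -
  have "rearr (cut k f) = rearr (cut k (rearr f))"
    using distr_fun_cut_cong[OF assms(2) distr_fun_rearr[OF assms(1)]] by (intro rearr_cong) simp
  then show ?thesis
    using rearr_decreasing_rcont[OF decreasing_rcont_cut[OF decreasing_rcont_rearr[OF assms(1)] assms(2)] assms(3)]
    by simp
qed

lemma rearr_mono:
  assumes "g \<in> L0" "AE t in halfline. \<bar>f t\<bar> \<le> \<bar>g t\<bar>" shows "rearr f t \<le> rearr g t"
  unfolding rearr_def using distr_fun_mono[OF assms]
  by (intro Inf_superset_mono) (blast intro: order_trans)

text \<open>
  The positive part of \<open>u - k\<close> lives on an initial interval \<open>[0, w)\<close>, so on that interval the
  constant \<open>k\<close> can be added back and cancelled.
\<close>

lemma prim_excess_le:
  assumes u: "decreasing_rcont u" and v: "decreasing_rcont v" and k: "0 \<le> k"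
    and le: "\<And>t. 0 < t \<Longrightarrow> prim u t \<le> prim v t" and t: "0 < t"
  shows "prim (excess k u) t \<le> prim (excess k v) t"
proof -
  have abs_u: "\<bar>u s\<bar> = u s" for s using decreasing_rcontD(1)[OF u] by simp
  have abs_v: "\<bar>v s\<bar> = v s" for s using decreasing_rcontD(1)[OF v] by simp
  \<comment> \<open>The length of the part of \<open>[0, t)\<close> on which \<open>u\<close>
    exceeds \<open>k\<close>; the minimum with \<open>t\<close> keeps it finite when
    \<open>distr_fun u k\<close> is infinite.\<close>
  define w where "w = enn2real (min (ennreal t) (distr_fun u k))"
  have "min (ennreal t) (distr_fun u k) \<le> ennreal t" by (rule min.cobounded1)
  then have fin: "min (ennreal t) (distr_fun u k) < top" by (rule le_less_trans) simp
  then have w: "ennreal w = min (ennreal t) (distr_fun u k)" by (simp add: w_def)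
  have w0: "0 \<le> w" by (simp add: w_def)
  have wt: "w \<le> t"
    using t w by (metis ennreal_le_iff less_imp_le min.cobounded1)
  have gt: "ereal k < u s \<longleftrightarrow> s < w" if "0 \<le> s" "s < t" for s
  proof -
    have "ereal k < u s \<longleftrightarrow> ennreal s < distr_fun u k"
      using rearr_gt_iff[OF decreasing_rcont_L0[OF u] k, of s] rearr_decreasing_rcont[OF u that(1)] by simp
    also have "\<dots> \<longleftrightarrow> ennreal s < ennreal w" using that by (simp add: w ennreal_less_iff)
    finally show ?thesis using that by (simp add: ennreal_less_iff)
  qed
  show ?thesis
  \<comment> \<open>Primitives are compared at positive arguments only, so an empty interval is
    treated separately.\<close>
  proof (cases "w = 0")
    case True
    have "excess k u s = 0" if "0 \<le> s" "s < t" for s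
      using gt[OF that] True that less_excess_iff[of 0 k u s] excess_nonneg[of k u s]
      by (simp add: abs_u zero_ereal_def[symmetric])
    then have "prim (excess k u) t = (\<integral>\<^sup>+ s. 0 \<partial>halfline)"
      unfolding prim_Ico by (intro nn_integral_cong) (auto simp: indicator_def e2ennreal_neg)
    then show ?thesis by simp
  next
    case False
    with w0 have w_pos: "0 < w" by simp
    have meas: "(\<lambda>s. e2ennreal (f s) * indicator {0..<w} s) \<in> borel_measurable halfline" if "f \<in> L0" for f
    proof -
      have [measurable]: "f \<in> borel_measurable halfline" "{0..<w} \<in> sets halfline"
        using that by (auto simp: L0_def intro: sets_halflineI)
      show ?thesis by measurable
    qed
    have kw: "(\<integral>\<^sup>+ s. ennreal k * indicator {0..<w} s \<partial>halfline) = ennreal (k * w)"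
      using w0 k by (subst nn_integral_cmult_indicator)
        (auto simp: emeasure_halfline_Ico ennreal_mult intro: sets_halflineI)
    have meas_k: "(\<lambda>s. ennreal k * indicator {0..<w} s) \<in> borel_measurable halfline"
      using meas[of "\<lambda>_. ereal k"] by (simp add: L0_def)
    have add: "prim f w + ennreal (k * w)
        = (\<integral>\<^sup>+ s. (e2ennreal (f s) + ennreal k) * indicator {0..<w} s \<partial>halfline)" if "f \<in> L0" for f
      unfolding prim_Ico kw[symmetric]
      by (subst nn_integral_add[symmetric, OF meas[OF that] meas_k]) (simp add: distrib_right)
    have "prim (excess k u) t + ennreal (k * w) = prim (excess k u) w + ennreal (k * w)"
    proof -
      have "excess k u s = 0" if "w \<le> s" "s < t" for s
        using gt[of s] w0 that less_excess_iff[of 0 k u s] excess_nonneg[of k u s]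
        by (simp add: abs_u zero_ereal_def[symmetric])
      then have "prim (excess k u) t = prim (excess k u) w"
        unfolding prim_Ico using wt
        by (intro nn_integral_cong) (auto simp: indicator_def e2ennreal_neg)
      then show ?thesis by simp
    qed
    also have "\<dots> = prim u w"
      unfolding add[OF excess_L0[OF decreasing_rcont_L0[OF u]]] unfolding prim_Ico
    proof (rule nn_integral_cong)
      fix s assume "s \<in> space halfline"
      then have s: "0 \<le> s" by simp
      show "(e2ennreal (excess k u s) + ennreal k) * indicator {0..<w} s
          = e2ennreal (u s) * indicator {0..<w} s"
      proof (cases "s < w")
        case True
        then have "ereal k < u s" using gt[OF s] wt by simp
        then show ?thesis using True s k
          by (cases "u s") (auto simp: excess_def zero_ereal_def max_def ennreal_plus[symmetric] simp del: ennreal_plus)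
      qed simp
    qed
    also have "\<dots> \<le> prim v w" by (rule le[OF w_pos])
    also have "\<dots> \<le> prim (excess k v) w + ennreal (k * w)"
      unfolding add[OF excess_L0[OF decreasing_rcont_L0[OF v]]] unfolding prim_Ico
    proof (rule nn_integral_mono)
      fix s
      have "e2ennreal (v s) \<le> e2ennreal (excess k v s) + ennreal k"
        using k decreasing_rcontD(1)[OF v, of s]
        by (cases "v s") (auto simp: excess_def zero_ereal_def max_def ennreal_plus[symmetric] ennreal_leI simp del: ennreal_plus)
      then show "e2ennreal (v s) * indicator {0..<w} s
          \<le> (e2ennreal (excess k v s) + ennreal k) * indicator {0..<w} s"
        by (intro mult_right_mono) auto
    qed
    also have "prim (excess k v) w \<le> prim (excess k v) t"
      unfolding prim_Ico using wt by (intro nn_integral_mono) (auto simp: indicator_def)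
    finally show ?thesis
      by (simp add: ennreal_add_left_cancel_le add.commute[of _ "ennreal (k * w)"] add_right_mono)
  qed
qed

section \<open>Pointwise and integral bounds for decreasing functions\<close>

lemma decreasing_rcont_AE_le:
  assumes u: "decreasing_rcont u" and v: "decreasing_rcont v"
    and le: "AE s in halfline. u s \<le> v s" and t: "0 \<le> t"
  shows "u t \<le> v t"
proof (rule ccontr)
  assume "\<not> u t \<le> v t"
  then obtain c where c: "v t < ereal c" "ereal c < u t" using ereal_dense2 by (auto simp: not_le)
  \<comment> \<open>Right continuity spreads a violation at \<open>t\<close> over all of
    \<open>[t, t')\<close>, which is not null.\<close>
  then obtain t' where t': "t < t'" "ereal c < u t'" using decreasing_rcontD(3)[OF u] by blast
  from AE_halfline_ex_Ico[OF le t t'(1)] obtain s where s: "t \<le> s" "s < t'" "u s \<le> v s" by auto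
  have "u t' \<le> u s" using s by (intro decreasing_rcontD(2)[OF u]) simp
  also note s(3)
  also have "v s \<le> v t" using s by (intro decreasing_rcontD(2)[OF v])
  finally show False using c t' by (meson less_le_trans not_less_iff_gr_or_eq)
qed

lemma nn_integral_le_of_prim:
  assumes "f \<in> L0" "\<And>t. 0 < t \<Longrightarrow> prim f t \<le> B"
  shows "(\<integral>\<^sup>+ s. e2ennreal (f s) \<partial>halfline) \<le> B"
proof -
  let ?g = "\<lambda>n s. e2ennreal (f s) * indicator {0..real (Suc n)} s"
  have "(\<integral>\<^sup>+ s. (SUP n. ?g n s) \<partial>halfline) = (SUP n. integral\<^sup>N halfline (?g n))"
  proof (rule nn_integral_monotone_convergence_SUP)
    show "incseq ?g" by (intro incseq_SucI le_funI) (auto simp: indicator_def)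
    show "?g n \<in> borel_measurable halfline" for n
    proof -
      have [measurable]: "f \<in> borel_measurable halfline" "{0..real (Suc n)} \<in> sets halfline"
        using assms(1) by (auto simp: L0_def intro: sets_halflineI)
      show ?thesis by measurable
    qed
  qed
  moreover have "(\<integral>\<^sup>+ s. e2ennreal (f s) \<partial>halfline) \<le> (\<integral>\<^sup>+ s. (SUP n. ?g n s) \<partial>halfline)"
  proof (rule nn_integral_mono)
    fix s assume "s \<in> space halfline"
    then have s: "0 \<le> s" by simp
    obtain n :: nat where "s < real n" using reals_Archimedean2 by blast
    then have "e2ennreal (f s) = ?g n s" using s by simp
    also have "\<dots> \<le> (SUP n. ?g n s)" by (rule SUP_upper) simp
    finally show "e2ennreal (f s) \<le> (SUP n. ?g n s)" .
  qed
  moreover have "(SUP n. integral\<^sup>N halfline (?g n)) \<le> B"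
    by (intro SUP_least assms(2)[unfolded prim_def]) simp
  ultimately show ?thesis by simp
qed

text \<open>Monotonicity gives \<open>t * f t \<le> prim f t\<close>. The resulting bound feeds
  Helly's theorem and controls the tails.\<close>

lemma decreasing_rcont_le_prim:
  assumes f: "decreasing_rcont f" and t: "0 < t" and B: "prim f t \<le> ennreal B" "0 \<le> B"
  shows "f t \<le> ereal (B / t)"
proof (rule ccontr)
  assume "\<not> ?thesis"
  then have "ereal (B / t) < f t" by simp
  then obtain c where c: "B / t < c" "ereal c < f t" using ereal_dense2 by (metis less_ereal.simps(1))
  have "ennreal c * ennreal t = (\<integral>\<^sup>+ s. ennreal c * indicator {0..<t} s \<partial>halfline)"
    using t by (subst nn_integral_cmult_indicator)
      (auto simp: emeasure_halfline_Ico intro: sets_halflineI)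
  also have "\<dots> \<le> prim f t"
    unfolding prim_Ico
  proof (rule nn_integral_mono)
    fix s
    have "ennreal c \<le> e2ennreal (f s)" if "s < t"
    proof -
      have "ereal c \<le> f s" using c(2) decreasing_rcontD(2)[OF f, of s t] that by (simp add: less_imp_le less_le_trans)
      from e2ennreal_mono[OF this] show ?thesis by simp
    qed
    then show "ennreal c * indicator {0..<t} s \<le> e2ennreal (f s) * indicator {0..<t} s"
      by (auto simp: indicator_def)
  qed
  also note B(1)
  finally have "ennreal (c * t) \<le> ennreal B" using t by (simp add: ennreal_mult'')
  then have "c * t \<le> B" using B(2) by (simp add: ennreal_le_iff)
  then show False using c(1) t by (simp add: pos_divide_less_eq)
qed

section \<open>Selection of a convergent subsequence\<close>

lemma continuous_at_right_mono_less:
  fixes F :: "real \<Rightarrow> real"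
  assumes "continuous (at_right t) F" "F t < a"
  shows "\<exists>t'>t. F t' < a"
proof -
  have "\<forall>\<^sub>F s in at_right t. F s < a"
    using assms order_tendstoD(2)[of F "F t" "at_right t" a] by (simp add: continuous_within)
  then obtain b where "b > t" "\<And>s. t < s \<Longrightarrow> s < b \<Longrightarrow> F s < a"
    by (auto simp: eventually_at_right_field)
  then show ?thesis using dense[of t b] by blast
qed

text \<open>
  The order-reversing homeomorphism from \<open>[0, \<infinity>]\<close> onto \<open>[0, 1]\<close> that makes Helly's theorem
  applicable to decreasing functions which may be unbounded near \<open>0\<close>.
\<close>

definition compress :: "ereal \<Rightarrow> real" where
  "compress y = (if y = \<infinity> then 0 else 1 / (1 + real_of_ereal y))"

lemma compress_bounds: "0 \<le> y \<Longrightarrow> 0 \<le> compress y \<and> compress y \<le> 1"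
  by (cases y) (auto simp: compress_def)

lemma compress_less_iff:
  assumes "0 \<le> y" "0 < a" shows "compress y < a \<longleftrightarrow> ereal (1 / a - 1) < y"
proof (cases y)
  case (real r)
  then have "0 < 1 + r" using assms(1) by simp
  then have "1 / (1 + r) < a \<longleftrightarrow> 1 / a - 1 < r"
    using assms(2) by (simp add: field_simps)
  then show ?thesis using real by (simp add: compress_def)
qed (use assms in \<open>auto simp: compress_def\<close>)

lemma compress_antimono: "0 \<le> x \<Longrightarrow> x \<le> y \<Longrightarrow> compress y \<le> compress x"
  by (cases x; cases y) (auto simp: compress_def intro: divide_left_mono)

text \<open>\<open>compress\<close> turns the functions into increasing right continuous ones with
  values in \<open>[0, 1]\<close>, to which Helly applies. The limit is carried back, and
  convergence can fail only at the countably many discontinuities of \<open>F\<close> and at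
  \<open>0\<close>.\<close>

lemma decreasing_rcont_selection:
  fixes Y :: "nat \<Rightarrow> real \<Rightarrow> ereal"
  assumes Y: "\<And>n. decreasing_rcont (Y n)"
    and bound: "\<And>n t. 0 < t \<Longrightarrow> Y n t \<le> ereal (B t)"
  obtains r z where "strict_mono r" "decreasing_rcont z"
    "AE t in halfline. (\<lambda>n. Y (r n) t) \<longlonglongrightarrow> z t"
proof -
  have Y0: "0 \<le> Y n t" for n t by (rule decreasing_rcontD(1)[OF Y])
  define f where "f n t = compress (Y n t)" for n t
  have f_mono: "mono (f n)" for n
    unfolding f_def by (intro monoI compress_antimono Y0 decreasing_rcontD(2)[OF Y])
  have f_rcont: "continuous (at_right t) (f n)" for n t
  proof (subst continuous_at_right_real_increasing)
    show "f n x \<le> f n y" if "x \<le> y" for x y using f_mono that by (rule monoD)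
    show "\<forall>e>0. \<exists>d>0. f n (t + d) - f n t < e"
    proof (intro allI impI)
      fix e :: real assume e: "0 < e"
      then have a: "0 < f n t + e" using compress_bounds[OF Y0, of n t] by (simp add: f_def)
      have "f n t < f n t + e" using e by simp
      then have "ereal (1 / (f n t + e) - 1) < Y n t"
        using compress_less_iff[OF Y0 a, of n t] by (simp add: f_def)
      then obtain t' where t': "t < t'" "ereal (1 / (f n t + e) - 1) < Y n t'"
        using decreasing_rcontD(3)[OF Y] by blast
      then have "f n t' < f n t + e" using compress_less_iff[OF Y0 a, of n t'] by (simp add: f_def)
      then show "\<exists>d>0. f n (t + d) - f n t < e" using t'(1) by (intro exI[of _ "t' - t"]) simp
    qed
  qed
  have "\<bar>f n t\<bar> \<le> 1" for n t using compress_bounds[OF Y0, of n t] by (simp add: f_def)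
  from Helly_selection[of f 1, OF f_rcont f_mono this] obtain r F where r: "strict_mono r"
    and F: "\<And>t. continuous (at_right t) F" "mono F" "\<And>t. \<bar>F t\<bar> \<le> 1"
    and lim: "\<And>t. continuous (at t) F \<Longrightarrow> (\<lambda>n. f (r n) t) \<longlonglongrightarrow> F t"
    by blast
  \<comment> \<open>The inverse of \<open>compress\<close>. Helly yields only
    \<open>\<bar>F t\<bar> \<le> 1\<close>, so all nonpositive values are sent to
    \<open>\<infinity>\<close>.\<close>
  define z where "z t = (if F t \<le> 0 then \<infinity> else ereal (1 / F t - 1))" for t
  have F1: "F t \<le> 1" for t using F(3)[of t] by simp
  have z_gt: "ereal c < z t \<longleftrightarrow> F t < 1 / (1 + c)" if "0 \<le> c" for c t
  proof (cases "F t \<le> 0")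
    case True
    have "0 < 1 / (1 + c)" using that by simp
    with True have "F t < 1 / (1 + c)" by (rule le_less_trans)
    then show ?thesis using True by (simp add: z_def)
  next
    case False
    then have "0 < F t" "0 < 1 + c" using that by auto
    then have "c < 1 / F t - 1 \<longleftrightarrow> F t < 1 / (1 + c)" by (simp add: field_simps)
    then show ?thesis using False by (simp add: z_def)
  qed
  have z0: "0 \<le> z t" for t
    using F1[of t] by (auto simp: z_def zero_ereal_def)
  have z: "decreasing_rcont z"
    unfolding decreasing_rcont_def
  proof (intro conjI allI impI)
    fix s t :: real assume "s \<le> t"
    then have "F s \<le> F t" using F(2) by (rule monoD[rotated])
    then show "z t \<le> z s" by (auto simp: z_def intro: divide_left_mono)
  next
    fix t c assume c: "ereal c < z t"
    show "\<exists>t'>t. ereal c < z t'"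
    proof (cases "0 \<le> c")
      case True
      then have "F t < 1 / (1 + c)" using c z_gt by simp
      then obtain t' where "t < t'" "F t' < 1 / (1 + c)"
        using continuous_at_right_mono_less[OF F(1)] by blast
      then show ?thesis using True z_gt by blast
    next
      case False
      then have "ereal c < z (t + 1)" by (intro less_le_trans[OF _ z0]) simp
      then show ?thesis by (intro exI[of _ "t + 1"]) simp
    qed
  qed (rule z0)
  have conv: "(\<lambda>n. Y (r n) t) \<longlonglongrightarrow> z t" if cont: "isCont F t" and t: "0 < t" for t
  proof -
    have lim_t: "(\<lambda>n. f (r n) t) \<longlonglongrightarrow> F t" by (rule lim[OF cont])
    have Y_eq: "Y n t = ereal (1 / f n t - 1)" and f_ge: "1 / (1 + B t) \<le> f n t" "0 < 1 + B t" for n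
    proof -
      obtain y where y: "Y n t = ereal y" "0 \<le> y" "y \<le> B t"
        using Y0[of n t] bound[OF t, of n] by (cases "Y n t") auto
      then show "Y n t = ereal (1 / f n t - 1)" "0 < 1 + B t" by (simp_all add: f_def compress_def)
      show "1 / (1 + B t) \<le> f n t" using y by (simp add: f_def compress_def frac_le)
    qed
    \<comment> \<open>The bound \<open>B t\<close> keeps the compressed values away from
      \<open>0\<close>, where the inverse of \<open>compress\<close> becomes infinite.\<close>
    have "1 / (1 + B t) \<le> F t" by (rule LIMSEQ_le_const[OF lim_t]) (use f_ge in blast)
    moreover have "0 < 1 / (1 + B t)" using f_ge(2) by simp
    ultimately have pos: "0 < F t" by linarith
    then have "(\<lambda>n. ereal (1 / f (r n) t - 1)) \<longlonglongrightarrow> ereal (1 / F t - 1)"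
      using lim_t by (intro tendsto_intros) auto
    then show ?thesis using pos by (simp add: Y_eq z_def)
  qed
  have "countable {t. \<not> isCont F t}" by (rule mono_ctble_discont[OF F(2)])
  then have "AE s in halfline. \<forall>t\<in>{t. \<not> isCont F t}. s \<noteq> t"
    by (subst AE_ball_countable) (simp_all add: AE_halfline_neq)
  with AE_halfline_neq[of 0] AE_space
  have "AE t in halfline. (\<lambda>n. Y (r n) t) \<longlonglongrightarrow> z t"
  proof eventually_elim
    case (elim t)
    then show ?case by (intro conv) auto
  qed
  with r z show ?thesis by (rule that)
qed

section \<open>Order continuity and the fundamental function\<close>

lemma LLUKM_pointI:
  assumes "x \<in> E"
    and "\<And>X. \<lbrakk>\<And>n. X n \<in> E; \<And>n. submaj (X n) x; (\<lambda>n. N (X n)) \<longlonglongrightarrow> N x\<rbrakk>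
      \<Longrightarrow> (\<lambda>n. N (\<lambda>t. rearr x t - rearr (X n) t)) \<longlonglongrightarrow> 0"
  shows "LLUKM_point E N x"
  using assms unfolding LLUKM_point_def by blast

lemma order_continuity_pointD:
  assumes "order_continuity_point E N x" "\<And>n. X n \<in> positive_cone E"
    "\<And>n. AE t in halfline. X n t \<le> \<bar>x t\<bar>" "AE t in halfline. (\<lambda>n. X n t) \<longlonglongrightarrow> 0"
  shows "(\<lambda>n. N (X n)) \<longlonglongrightarrow> 0"
  using assms(1)[unfolded order_continuity_point_def, THEN conjunct2, rule_format, of X] assms(2-)
  by blast

context fatou_symmetric_space
begin

lemma excess_mem: "0 \<le> k \<Longrightarrow> x \<in> E \<Longrightarrow> excess k x \<in> E"
  using ideal[OF excess_L0[OF measurable], of x x k] excess_le excess_nonneg[of k x] by simp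

lemma norm_excess_rearr:
  assumes "0 \<le> k" "x \<in> E"
  shows "N (excess k (rearr x)) = N (excess k x)"
  using symmetric[OF excess_L0[OF rearr_L0[OF measurable[OF assms(2)]]] excess_mem[OF assms]
      distr_fun_excess_cong[OF distr_fun_rearr[OF measurable[OF assms(2)]]]]
  by simp

lemma norm_excess_submaj_le:
  assumes "decreasing_rcont u" "decreasing_rcont v" "v \<in> E" "0 \<le> k"
    and "\<And>t. 0 < t \<Longrightarrow> prim u t \<le> prim v t"
  shows "excess k u \<in> E" "N (excess k u) \<le> N (excess k v)"
  using decreasing_submaj_norm_le[OF decreasing_rcont_excess[OF assms(1)] decreasing_rcont_excess[OF assms(2)]
      excess_mem[OF assms(4,3)] prim_excess_le[OF assms(1,2,4,5)]]
  by simp_all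

lemma diff_mem:
  assumes "x \<in> E" "y \<in> E" shows "(\<lambda>t. x t - y t) \<in> E" "N (\<lambda>t. x t - y t) \<le> N x + N y"
proof -
  have [measurable]: "x \<in> borel_measurable halfline" "y \<in> borel_measurable halfline"
    using measurable assms by (auto simp: L0_def)
  have L: "(\<lambda>t. x t - y t) \<in> L0" unfolding L0_def by measurable
  have "\<bar>x t - y t\<bar> \<le> \<bar>x t\<bar> + \<bar>y t\<bar>" for t
    by (cases "x t"; cases "y t") auto
  then have ae: "AE t in halfline. \<bar>x t - y t\<bar> \<le> \<bar>x t\<bar> + \<bar>y t\<bar>" by simp
  show "(\<lambda>t. x t - y t) \<in> E" "N (\<lambda>t. x t - y t) \<le> N x + N y"
    by (rule norm_le_add[OF L assms ae])+
qed

lemma norm_diff_commute: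
  assumes "x \<in> E" "y \<in> E" shows "N (\<lambda>t. x t - y t) = N (\<lambda>t. y t - x t)"
proof (rule norm_cong_abs_AE(2)[OF diff_mem(1)[OF assms(2,1)] measurable[OF diff_mem(1)[OF assms]]])
  show "AE t in halfline. \<bar>x t - y t\<bar> = \<bar>y t - x t\<bar>"
    using ae_finite[OF assms(1)] ae_finite[OF assms(2)]
  proof eventually_elim
    case (elim t)
    then show ?case by (cases "x t"; cases "y t") auto
  qed
qed

lemma norm_triangle_diff:
  assumes "x \<in> E" "y \<in> E" shows "N x \<le> N y + N (\<lambda>t. x t - y t)"
proof (rule norm_le_add(2)[OF measurable[OF assms(1)] assms(2) diff_mem(1)[OF assms]])
  show "AE t in halfline. \<bar>x t\<bar> \<le> \<bar>y t\<bar> + \<bar>x t - y t\<bar>"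
    using ae_finite[OF assms(1)] ae_finite[OF assms(2)]
  proof eventually_elim
    case (elim t)
    then show ?case by (cases "x t"; cases "y t") auto
  qed
qed

lemma norm_excess_tendsto_0:
  assumes "order_continuity_point E N x"
  shows "(\<lambda>n. N (excess (real n) x)) \<longlonglongrightarrow> 0"
proof -
  have x: "x \<in> E" using assms by (simp add: order_continuity_point_def)
  have "AE t in halfline. (\<lambda>n. excess (real n) x t) \<longlonglongrightarrow> 0"
    using ae_finite[OF x]
  proof eventually_elim
    case (elim t)
    then obtain r where r: "\<bar>x t\<bar> = ereal r" by (cases "x t") auto
    obtain m :: nat where m: "r < real m" using reals_Archimedean2 by blast
    have "excess (real n) x t = 0" if "m \<le> n" for n
      using that m r by (simp add: excess_def zero_ereal_def)
    then show ?case by (intro tendsto_eventually eventually_sequentiallyI[of m]) 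
  qed
  moreover have "excess (real n) x \<in> positive_cone E" for n
    using excess_mem[of "real n"] x by (simp add: positive_cone_def excess_nonneg)
  moreover have "AE t in halfline. excess (real n) x t \<le> \<bar>x t\<bar>" for n
    by (simp add: excess_le)
  ultimately show ?thesis
    by (intro order_continuity_pointD[OF assms])
qed

section \<open>Behaviour of the fundamental function at \<open>0\<close>\<close>

lemma ex_distr_fun_pos:
  assumes x: "x \<in> L0" and nz: "\<not> (AE t in halfline. x t = 0)"
  shows "\<exists>c>0. 0 < distr_fun x c"
proof -
  have "distr_fun x 0 \<noteq> 0"
  proof
    assume "distr_fun x 0 = 0"
    then have "{s \<in> {0..}. \<bar>x s\<bar> > ereal 0} \<in> null_sets halfline"
      using L0_abs_gt_sets[OF x, of 0] by (auto simp: distr_fun_def)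
    from AE_not_in[OF this] AE_space have "AE t in halfline. x t = 0"
    proof eventually_elim
      case (elim t)
      then show ?case by (cases "x t") auto
    qed
    then show False using nz by simp
  qed
  then show ?thesis using distr_fun_right_cont[OF x, of 0 0] by (auto simp: zero_less_iff_neq_zero)
qed

text \<open>A nonzero \<open>x\<close> has \<open>rearr x > c > 0\<close> near \<open>0\<close>, so
  smallness of the product forces smallness of \<open>fundamental_fun N\<close>.\<close>

lemma fundamental_fun_at_0_of_rearr:
  assumes x: "x \<in> L0" and nz: "\<not> (AE t in halfline. x t = 0)"
    and lim: "((\<lambda>t. rearr x t * ereal (fundamental_fun N t)) \<longlongrightarrow> 0) (at_right 0)"
    and e: "0 < e"
  shows "\<exists>d>0. fundamental_fun N d < e"
proof -
  obtain c where c: "0 < c" "0 < distr_fun x c" using ex_distr_fun_pos[OF x nz] by blast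
  have "((\<lambda>t::real. ennreal t) \<longlongrightarrow> ennreal 0) (at_right 0)"
    by (intro tendsto_ennrealI tendsto_ident_at)
  then have 1: "\<forall>\<^sub>F t in at_right 0. ennreal t < distr_fun x c"
    using c(2) by (intro order_tendstoD(2)) auto
  have 2: "\<forall>\<^sub>F t in at_right 0. rearr x t * ereal (fundamental_fun N t) < ereal (c * e)"
    using lim c e by (intro order_tendstoD(2)) auto
  have 3: "\<forall>\<^sub>F t in at_right (0::real). 0 < t" by (simp add: eventually_at_right_less)
  obtain t where t: "ennreal t < distr_fun x c"
    "rearr x t * ereal (fundamental_fun N t) < ereal (c * e)" "0 < t"
    using eventually_happens'[OF _ eventually_conj[OF 1 eventually_conj[OF 2 3]]] by auto
  have "ereal c * ereal (fundamental_fun N t) \<le> rearr x t * ereal (fundamental_fun N t)"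
    using t(1) c(1) rearr_gt_iff[OF x, of c t] fundamental_fun_nonneg[of t]
    by (intro ereal_mult_right_mono) auto
  from le_less_trans[OF this t(2)] have "c * fundamental_fun N t < c * e" by simp
  then have "fundamental_fun N t < e" using c(1) by simp
  then show ?thesis using t(3) by blast
qed

text \<open>
  Order continuity is applied to multiples of indicators of \<open>A \<inter> [0, q + 1/n]\<close>, where \<open>q\<close> is the
  essential infimum of a set \<open>A\<close> on which \<open>x\<close> is bounded away from \<open>0\<close>.
\<close>

lemma fundamental_fun_at_0_of_order_continuity:
  assumes oc: "order_continuity_point E N x" and nz: "\<not> (AE t in halfline. x t = 0)"
    and e: "0 < e"
  shows "\<exists>d>0. fundamental_fun N d < e"
proof -
  have x: "x \<in> E" using oc by (simp add: order_continuity_point_def)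
  obtain c where c: "0 < c" "0 < distr_fun x c"
    using ex_distr_fun_pos[OF measurable[OF x] nz] by blast
  define A where "A = {s \<in> {0..}. ereal c < \<bar>x s\<bar>}"
  have A: "A \<in> sets halfline" unfolding A_def by (rule L0_abs_gt_sets[OF measurable[OF x]])
  have A_pos: "0 < emeasure halfline A" using c(2) by (simp add: A_def distr_fun_def)
  have AI: "A \<inter> {0..q} \<in> sets halfline" for q by (rule sets.Int[OF A sets_halflineI]) auto
  define Q where "Q = {q. 0 \<le> q \<and> 0 < emeasure halfline (A \<inter> {0..q})}"
  have "\<exists>n::nat. 0 < emeasure halfline (A \<inter> {0..real n})"
  proof (rule ccontr)
    assume "\<not> ?thesis"
    then have "(\<Union>n::nat. A \<inter> {0..real n}) \<in> null_sets halfline" using AI by (intro null_sets_UN) auto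
    moreover have "(\<Union>n::nat. A \<inter> {0..real n}) = A"
    proof (intro equalityI subsetI)
      fix s assume s: "s \<in> A"
      obtain n :: nat where "s < real n" using reals_Archimedean2 by blast
      then have "s \<in> A \<inter> {0..real n}" using s by (simp add: A_def)
      then show "s \<in> (\<Union>n::nat. A \<inter> {0..real n})" by blast
    qed auto
    ultimately show False using A_pos by auto
  qed
  then obtain n :: nat where "real n \<in> Q" by (auto simp only: Q_def mem_Collect_eq of_nat_0_le_iff)
  then have Q_ne: "Q \<noteq> {}" by blast
  have Q_bdd: "bdd_below Q" by (rule bdd_belowI[of _ 0]) (simp add: Q_def)
  define q where "q = Inf Q"
  have q0: "0 \<le> q" unfolding q_def by (rule cInf_greatest[OF Q_ne]) (simp add: Q_def)
  define B where "B n = A \<inter> {0..q + 1 / real (Suc n)}" for n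
  have B: "B n \<in> sets halfline" for n unfolding B_def by (rule AI)
  have B_pos: "0 < emeasure halfline (B n)" for n
  proof -
    have "Inf Q < q + 1 / real (Suc n)" by (simp add: q_def)
    then obtain p where p: "p \<in> Q" "p < q + 1 / real (Suc n)" using cInf_lessD[OF Q_ne] by blast
    have "emeasure halfline (A \<inter> {0..p}) \<le> emeasure halfline (B n)"
      using B p(2) unfolding B_def by (intro emeasure_mono) auto
    with p(1) show ?thesis by (auto simp: Q_def)
  qed
  have B_fin: "emeasure halfline (B n) \<noteq> \<infinity>" for n
  proof -
    have "emeasure halfline (B n) \<le> emeasure halfline {0..<q + 2}"
    proof (rule emeasure_mono)
      have "1 / real (Suc n) \<le> 1" by simp
      then have "q + 1 / real (Suc n) < q + 2" by linarith
      then show "B n \<subseteq> {0..<q + 2}" unfolding B_def by (auto simp del: of_nat_Suc)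
    qed (auto intro: sets_halflineI)
    also have "\<dots> = ennreal (q + 2)" using q0 by (simp add: emeasure_halfline_Ico)
    finally show ?thesis by (auto simp: top_unique)
  qed
  define d where "d n = enn2real (emeasure halfline (B n))" for n
  have d: "emeasure halfline (B n) = ennreal (d n)" "0 < d n" for n
    using B_pos[of n] B_fin[of n] by (simp_all add: d_def enn2real_positive_iff less_top)
  let ?X = "\<lambda>n t. ereal c * indicator (B n) t :: ereal"
  have XE: "?X n \<in> E" and XN: "N (?X n) = c * fundamental_fun N (d n)" for n
    using cmult_indicator_mem[OF indicator_finite_mem(1)[OF B d(1) less_imp_le[OF d(2)]]]
      indicator_finite_mem(2)[OF B d(1) less_imp_le[OF d(2)]] c(1)
    by simp_all
  have "AE t in halfline. (\<lambda>n. ?X n t) \<longlonglongrightarrow> 0"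
  proof -
    \<comment> \<open>Nothing below \<open>q\<close> belongs to \<open>Q\<close>, so almost no point
      of \<open>A\<close> lies to the left of \<open>q\<close>. This makes the sets
      \<open>B n\<close> shrink to a null set.\<close>
    have "AE t in halfline. t \<notin> A \<inter> {0..q - 1 / real (Suc n)}" for n
    proof (rule AE_not_in)
      have "q - 1 / real (Suc n) \<notin> Q"
      proof
        assume "q - 1 / real (Suc n) \<in> Q"
        then have "q \<le> q - 1 / real (Suc n)" unfolding q_def by (intro cInf_lower Q_bdd)
        then show False by simp
      qed
      then have "emeasure halfline (A \<inter> {0..q - 1 / real (Suc n)}) = 0"
        by (cases "0 \<le> q - 1 / real (Suc n)") (auto simp: Q_def zero_less_iff_neq_zero)
      then show "A \<inter> {0..q - 1 / real (Suc n)} \<in> null_sets halfline" using AI by (intro null_setsI)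
    qed
    then have "AE t in halfline. \<forall>n. t \<notin> A \<inter> {0..q - 1 / real (Suc n)}"
      by (simp only: AE_all_countable) blast
    with AE_halfline_neq[of q] AE_space show ?thesis
    proof eventually_elim
      case (elim t)
      then have t: "0 \<le> t" "t \<noteq> q" by auto
      show ?case
      proof (cases "t < q")
        case True
        then obtain n where n: "inverse (real (Suc n)) < q - t" using reals_Archimedean[of "q - t"] by auto
        then have "t \<le> q - 1 / real (Suc n)" by (simp add: inverse_eq_divide)
        then have "t \<notin> A" using elim t by auto
        then show ?thesis by (simp add: B_def)
      next
        case False
        then obtain m where m: "inverse (real (Suc m)) < t - q" using reals_Archimedean[of "t - q"] t by auto
        have "?X n t = 0" if "m \<le> n" for n
        proof -
          have "1 / real (Suc n) \<le> 1 / real (Suc m)" using that by (intro divide_left_mono) auto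
          then have "q + 1 / real (Suc n) < t" using m by (simp add: inverse_eq_divide)
          then show ?thesis by (simp add: B_def)
        qed
        then show ?thesis by (intro tendsto_eventually eventually_sequentiallyI[of m])
      qed
    qed
  qed
  moreover have "?X n \<in> positive_cone E" for n using XE c(1) by (simp add: positive_cone_def)
  moreover have "AE t in halfline. ?X n t \<le> \<bar>x t\<bar>" for n
    by (intro AE_I2) (auto simp: B_def A_def indicator_def less_imp_le)
  ultimately have "(\<lambda>n. N (?X n)) \<longlonglongrightarrow> 0"
    by (intro order_continuity_pointD[OF oc])
  then have "\<forall>\<^sub>F n in sequentially. N (?X n) < c * e"
    using c(1) e by (intro order_tendstoD(2)) auto
  then obtain n where "N (?X n) < c * e" by (auto simp: eventually_sequentially)
  then have "fundamental_fun N (d n) < e" using c(1) by (simp add: XN)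
  then show ?thesis using d(2) by blast
qed

end

section \<open>From LLUKM points to order continuity\<close>

context fatou_symmetric_space
begin

text \<open>On \<open>[0, t)\<close> the constant \<open>rearr x t\<close> is at most
  \<open>excess k (rearr x) + k\<close>. Taking norms bounds the product by
  \<open>N (excess k x) + k * fundamental_fun N t\<close>: first \<open>k\<close> is chosen large,
  then \<open>t\<close> small.\<close>

lemma rearr_tendsto_0_of_order_continuity:
  assumes oc: "order_continuity_point E N x"
  shows "((\<lambda>t. rearr x t * ereal (fundamental_fun N t)) \<longlongrightarrow> 0) (at_right 0)"
proof (cases "AE t in halfline. x t = 0")
  case True
  have "x \<in> E" using oc by (simp add: order_continuity_point_def)
  then show ?thesis using rearr_eq_zero[OF measurable True] by simp
next
  case False
  have x: "x \<in> E" using oc by (simp add: order_continuity_point_def)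
  let ?u = "rearr x"
  have u: "decreasing_rcont ?u" and uE: "?u \<in> E"
    using decreasing_rcont_rearr[OF measurable[OF x]] rearr_mem[OF x] by auto
  have bound: "\<exists>r\<ge>0. ?u t = ereal r \<and> r * fundamental_fun N t \<le> N (excess k x) + k * fundamental_fun N t"
    if t: "0 < t" and k: "0 \<le> k" for t k
  proof -
    \<comment> \<open>\<open>rearr x\<close> is finite somewhere in \<open>[0, t)\<close>, hence at
      \<open>t\<close> by monotonicity.\<close>
    obtain s where s: "0 \<le> s" "s < t" "\<bar>?u s\<bar> \<noteq> \<infinity>"
      using AE_halfline_ex_Ico[OF ae_finite[OF uE] order_refl t] by auto
    then have "?u t \<noteq> \<infinity>" using decreasing_rcontD(2)[OF u, of s t] by auto
    then obtain r where r: "?u t = ereal r" "0 \<le> r" using rearr_nonneg[of x t] by (cases "?u t") auto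
    let ?f = "\<lambda>s. ereal r * indicator {0..<t} s :: ereal"
    let ?g = "\<lambda>s. ereal k * indicator {0..<t} s :: ereal"
    have f: "?f \<in> E" "N ?f = r * fundamental_fun N t" and g: "?g \<in> E" "N ?g = k * fundamental_fun N t"
      using cmult_indicator_mem[OF indicator_Ico_mem] r(2) k t by (simp_all add: norm_indicator_Ico)
    have "N ?f \<le> N (excess k ?u) + N ?g"
    proof (rule norm_le_add(2)[OF measurable[OF f(1)] excess_mem[OF k uE] g(1)], rule AE_I2)
      fix s
      show "\<bar>?f s\<bar> \<le> \<bar>excess k ?u s\<bar> + \<bar>?g s\<bar>"
      proof (cases "s \<in> {0..<t}")
        case True
        then have "ereal r \<le> ?u s" using decreasing_rcontD(2)[OF u, of s t] r by simp
        then show ?thesis using True r(2) k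
          by (cases "?u s") (auto simp: excess_def zero_ereal_def max_def)
      qed simp
    qed
    then have "r * fundamental_fun N t \<le> N (excess k x) + k * fundamental_fun N t"
      unfolding f(2) g(2) norm_excess_rearr[OF k x] .
    then show ?thesis using r by blast
  qed
  show ?thesis
  proof (rule order_tendstoI)
    fix a :: ereal assume "a < 0"
    then show "\<forall>\<^sub>F t in at_right 0. a < ?u t * ereal (fundamental_fun N t)"
      by (intro always_eventually allI) (erule less_le_trans, intro ereal_0_le_mult rearr_nonneg, simp add: fundamental_fun_nonneg)
  next
    fix a :: ereal assume "0 < a"
    then obtain e where e: "0 < e" "ereal e < a" using ereal_dense2[of 0 a] by auto
    have "\<forall>\<^sub>F n in sequentially. N (excess (real n) x) < e / 2"
      using norm_excess_tendsto_0[OF oc] e by (intro order_tendstoD(2)) auto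
    then obtain n where n: "N (excess (real n) x) < e / 2" by (auto simp: eventually_sequentially)
    \<comment> \<open>The denominator contains \<open>real n + 1\<close> because \<open>n\<close>
      may be \<open>0\<close>.\<close>
    have "0 < e / (2 * (real n + 1))" using e by simp
    from fundamental_fun_at_0_of_order_continuity[OF oc False this]
    obtain d where d: "0 < d" "fundamental_fun N d < e / (2 * (real n + 1))" by blast
    have "?u t * ereal (fundamental_fun N t) < a" if t: "0 < t" "t < d" for t
    proof -
      from bound[OF t(1), of "real n"] obtain r where r: "?u t = ereal r"
        "r * fundamental_fun N t \<le> N (excess (real n) x) + real n * fundamental_fun N t"
        using of_nat_0_le_iff by blast
      have "fundamental_fun N t < e / (2 * (real n + 1))"
        using fundamental_fun_mono[of t d] t d by simp
      then have "(real n + 1) * fundamental_fun N t < e / 2" by (simp add: field_simps)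
      then have "real n * fundamental_fun N t < e / 2"
        using fundamental_fun_nonneg[of t] by (simp add: algebra_simps)
      then have "r * fundamental_fun N t < e" using r(2) n by simp
      then have "?u t * ereal (fundamental_fun N t) < ereal e" by (simp add: r(1))
      then show ?thesis using e(2) by (rule less_trans)
    qed
    then show "\<forall>\<^sub>F t in at_right 0. ?u t * ereal (fundamental_fun N t) < a"
      using d(1) by (auto simp: eventually_at_right_field)
  qed
qed

lemma LKM_of_LLUKM:
  assumes "LLUKM_point E N x" shows "LKM_point E N x"
proof -
  have x: "x \<in> E" using assms by (simp add: LLUKM_point_def)
  have "N y < N x" if y: "y \<in> E" and ne: "\<exists>t\<ge>0. rearr x t \<noteq> rearr y t" and sub: "submaj y x" for y
  proof (rule ccontr)
    \<comment> \<open>Full symmetry turns failure of strictness into equality of the norms, so the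
      constant sequence \<open>y\<close> is admissible in the LLUKM condition.\<close>
    assume "\<not> N y < N x"
    then have eq: "N y = N x" using submaj_norm_le(2)[OF measurable[OF y] x sub] by simp
    let ?d = "\<lambda>t. rearr x t - rearr y t"
    have "(\<lambda>n::nat. N ?d) \<longlonglongrightarrow> 0"
      using assms[unfolded LLUKM_point_def, THEN conjunct2, rule_format, of "\<lambda>_. y"] y sub eq by simp
    then have "N ?d = 0" by (simp add: LIMSEQ_const_iff)
    then have "AE t in halfline. ?d t = 0"
      using norm_eq_0[OF diff_mem(1)[OF rearr_mem(1)[OF x] rearr_mem(1)[OF y]]] by simp
    then have ae: "AE t in halfline. rearr x t = rearr y t"
    proof eventually_elim
      case (elim t)
      then show ?case by (cases "rearr x t"; cases "rearr y t") auto
    qed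
    have "rearr x t = rearr y t" if "0 \<le> t" for t
    proof (rule antisym)
      show "rearr x t \<le> rearr y t"
        by (rule decreasing_rcont_AE_le) (use ae that in \<open>auto intro!: decreasing_rcont_rearr measurable x y\<close>)
      show "rearr y t \<le> rearr x t"
        by (rule decreasing_rcont_AE_le) (use ae that in \<open>auto intro!: decreasing_rcont_rearr measurable x y\<close>)
    qed
    then show False using ne by blast
  qed
  with x show ?thesis unfolding LKM_point_def by blast
qed

text \<open>The Fatou property makes the truncations of \<open>x\<close> an admissible test
  sequence. As truncation commutes with rearrangement, the difference of rearrangements is
  \<open>excess n (rearr x)\<close>.\<close>

lemma norm_excess_tendsto_0_of_LLUKM:
  assumes "LLUKM_point E N x"
  shows "(\<lambda>n. N (excess (real n) x)) \<longlonglongrightarrow> 0"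
proof -
  have x: "x \<in> E" using assms by (simp add: LLUKM_point_def)
  let ?X = "\<lambda>n. cut (real n) x"
  have le: "\<bar>?X n t\<bar> \<le> \<bar>x t\<bar>" for n t by (simp add: cut_nonneg) (simp add: cut_def)
  have XE: "?X n \<in> E" for n using ideal[OF cut_L0[OF measurable[OF x]] x] le by blast
  have sub: "submaj (?X n) x" for n
    unfolding submaj_iff using le by (intro allI impI prim_mono rearr_mono measurable[OF x]) simp
  have "(\<lambda>n. N (?X n)) \<longlonglongrightarrow> N (\<lambda>t. \<bar>x t\<bar>)"
  proof (rule fatou[unfolded fatou_property_def, rule_format, THEN conjunct2, THEN conjunct2], intro conjI allI)
    show "?X n \<in> positive_cone E" for n using XE by (simp add: positive_cone_def cut_nonneg)
    show "bdd_above (range (\<lambda>n. N (?X n)))"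
      using ideal[OF cut_L0[OF measurable[OF x]] x] le by (intro bdd_aboveI2[of _ _ "N x"]) blast
    show "(\<lambda>t. \<bar>x t\<bar>) \<in> L0" by (rule measurable[OF abs_mem(1)[OF x]])
    show "AE t in halfline. incseq (\<lambda>n. ?X n t) \<and> (\<lambda>n. ?X n t) \<longlonglongrightarrow> \<bar>x t\<bar>"
      using ae_finite[OF x]
    proof eventually_elim
      case (elim t)
      then obtain r where r: "\<bar>x t\<bar> = ereal r" by (cases "x t") auto
      obtain m :: nat where m: "r < real m" using reals_Archimedean2 by blast
      have "?X n t = \<bar>x t\<bar>" if "m \<le> n" for n using that m r by (simp add: cut_def)
      then have "(\<lambda>n. ?X n t) \<longlonglongrightarrow> \<bar>x t\<bar>"
        by (intro tendsto_eventually eventually_sequentiallyI[of m])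
      moreover have "incseq (\<lambda>n. ?X n t)"
        unfolding cut_def by (intro incseq_SucI min.mono) auto
      ultimately show ?case by blast
    qed
  qed
  then have "(\<lambda>n. N (?X n)) \<longlonglongrightarrow> N x" by (simp add: abs_mem(2)[OF x])
  then have lim: "(\<lambda>n. N (\<lambda>t. rearr x t - rearr (?X n) t)) \<longlonglongrightarrow> 0"
    using assms[unfolded LLUKM_point_def, THEN conjunct2, rule_format, of ?X] XE sub by blast
  have "N (excess (real n) x) = N (\<lambda>t. rearr x t - rearr (?X n) t)" for n
  proof -
    have "N (excess (real n) x) = N (excess (real n) (rearr x))"
      by (rule norm_excess_rearr[symmetric]) (simp_all add: x)
    also have "\<dots> = N (\<lambda>t. rearr x t - rearr (?X n) t)"
    proof (rule norm_cong_abs_AE(2)[OF diff_mem(1)[OF rearr_mem(1)[OF x] rearr_mem(1)[OF XE]]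
          excess_L0[OF rearr_L0[OF measurable[OF x]]]])
      show "AE t in halfline. \<bar>excess (real n) (rearr x) t\<bar> = \<bar>rearr x t - rearr (?X n) t\<bar>"
        using ae_finite[OF rearr_mem(1)[OF x]] AE_space
      proof eventually_elim
        case (elim t)
        then obtain r where "rearr x t = ereal r" "0 \<le> r"
          using rearr_nonneg[of x t] by (cases "rearr x t") auto
        then show ?case using rearr_cut[OF measurable[OF x], of "real n" t] elim(2)
          by (simp add: excess_def cut_def zero_ereal_def max_def min_def)
      qed
    qed
    finally show ?thesis .
  qed
  then show ?thesis using lim by simp
qed

text \<open>
  The truncation \<open>cut k\<close> of the sequence is bounded and tends to \<open>0\<close> in \<open>L\<^sup>1\<close> by dominated
  convergence; what is cut off is at most \<open>excess k x\<close>.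
\<close>

lemma order_continuity_of_excess:
  assumes x: "x \<in> E" "x \<in> L1"
    and excess: "(\<lambda>n. N (excess (real n) x)) \<longlonglongrightarrow> 0"
    and at_0: "\<And>e. 0 < e \<Longrightarrow> \<exists>d>0. fundamental_fun N d < e"
  shows "order_continuity_point E N x"
  unfolding order_continuity_point_def
proof (intro conjI x(1) allI impI, elim conjE)
  fix X :: "nat \<Rightarrow> real \<Rightarrow> ereal"
  assume X: "\<forall>n. X n \<in> positive_cone E" "\<forall>n. AE t in halfline. X n t \<le> \<bar>x t\<bar>"
    "AE t in halfline. (\<lambda>n. X n t) \<longlonglongrightarrow> 0"
  have XE: "X n \<in> E" and X0: "AE t in halfline. 0 \<le> X n t" for n
    using X(1) by (auto simp: positive_cone_def)
  show "(\<lambda>n. N (X n)) \<longlonglongrightarrow> 0"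
  proof (rule order_tendstoI)
    fix a :: real assume "a < 0"
    then show "\<forall>\<^sub>F n in sequentially. a < N (X n)"
      using norm_nonneg[OF XE] by (intro always_eventually allI) (rule less_le_trans)
  next
    fix e :: real assume e: "0 < e"
    have "\<forall>\<^sub>F n in sequentially. N (excess (real n) x) < e / 2"
      using excess e by (intro order_tendstoD(2)) auto
    then obtain m where "\<And>n. m \<le> n \<Longrightarrow> N (excess (real n) x) < e / 2"
      by (auto simp: eventually_sequentially)
    \<comment> \<open>\<open>Suc m\<close> is taken so that the truncation level \<open>k\<close> is
      positive.\<close>
    from this[of "Suc m"] have m: "N (excess (real (Suc m)) x) < e / 2" by (simp del: of_nat_Suc)
    define k where "k = real (Suc m)"
    have k: "0 < k" by (simp add: k_def)
    then have "0 < e / (2 * k)" using e by simp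
    from at_0[OF this] obtain d where d: "0 < d" "fundamental_fun N d < e / (2 * k)" by blast
    have kd: "k * fundamental_fun N d < e / 2" using d(2) k by (simp add: field_simps)
    have [measurable]: "X n \<in> borel_measurable halfline" "x \<in> borel_measurable halfline" for n
      using measurable XE x(1) by (auto simp: L0_def)
    have "(\<lambda>n. \<integral>\<^sup>+ t. e2ennreal \<bar>cut k (X n) t\<bar> \<partial>halfline) \<longlonglongrightarrow> (\<integral>\<^sup>+ t. 0 \<partial>halfline)"
    proof (rule nn_integral_dominated_convergence[where w = "\<lambda>t. e2ennreal \<bar>x t\<bar>"])
      show "(\<lambda>t. e2ennreal \<bar>cut k (X n) t\<bar>) \<in> borel_measurable halfline" for n
        unfolding cut_def by measurable
      show "AE t in halfline. e2ennreal \<bar>cut k (X n) t\<bar> \<le> e2ennreal \<bar>x t\<bar>" for n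
        using X(2)[rule_format, of n] X0[of n]
      proof eventually_elim
        case (elim t)
        then have "\<bar>cut k (X n) t\<bar> \<le> \<bar>x t\<bar>"
          using k by (simp add: cut_nonneg) (simp add: cut_def min.coboundedI1)
        then show ?case by (rule e2ennreal_mono)
      qed
      show "(\<integral>\<^sup>+ t. e2ennreal \<bar>x t\<bar> \<partial>halfline) < \<infinity>" using x(2) by (simp add: L1_def)
      have X0': "AE t in halfline. \<forall>n. 0 \<le> X n t" using X0 by (simp add: AE_all_countable)
      show "AE t in halfline. (\<lambda>n. e2ennreal \<bar>cut k (X n) t\<bar>) \<longlonglongrightarrow> 0"
        using X(3) X0'
      proof eventually_elim
        case (elim t)
        have "(\<lambda>n. e2ennreal (X n t)) \<longlonglongrightarrow> e2ennreal 0"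
          using continuous_at_e2ennreal elim(1) by (rule isCont_tendsto_compose)
        then have "(\<lambda>n. e2ennreal (X n t)) \<longlonglongrightarrow> 0" by (simp add: e2ennreal_neg)
        then show ?case
        proof (rule tendsto_sandwich[OF _ _ tendsto_const, rotated 2])
          show "\<forall>\<^sub>F n in sequentially. e2ennreal \<bar>cut k (X n) t\<bar> \<le> e2ennreal (X n t)"
            using elim(2) k by (intro always_eventually allI e2ennreal_mono)
              (simp add: cut_nonneg, simp add: cut_def)
        qed simp
      qed
    qed simp_all
    \<comment> \<open>A bound \<open>k\<close> together with an integral below \<open>k * d\<close>
      gives norm at most \<open>k * fundamental_fun N d\<close>, which is less than
      \<open>e / 2\<close>.\<close>
    then have "\<forall>\<^sub>F n in sequentially. (\<integral>\<^sup>+ t. e2ennreal \<bar>cut k (X n) t\<bar> \<partial>halfline) < ennreal (k * d)"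
      using k d(1) by (intro order_tendstoD(2)) auto
    then show "\<forall>\<^sub>F n in sequentially. N (X n) < e"
    proof eventually_elim
      case (elim n)
      have "AE t in halfline. \<bar>cut k (X n) t\<bar> \<le> ereal k"
        using k by (intro AE_I2) (simp add: cut_nonneg, simp add: cut_def)
      from norm_le_bounded_integrable[OF cut_L0[OF measurable[OF XE]] _ _ this less_imp_le[OF elim]]
      have cut: "cut k (X n) \<in> E" "N (cut k (X n)) \<le> k * fundamental_fun N d" using k d(1) by simp_all
      have xk: "excess k x \<in> E" using k x by (intro excess_mem) simp_all
      have "AE t in halfline. \<bar>X n t\<bar> \<le> \<bar>excess k x t\<bar> + \<bar>cut k (X n) t\<bar>"
        using X(2)[rule_format, of n] X0[of n]
      proof eventually_elim
        case (elim t)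
        have "\<bar>X n t\<bar> = cut k (X n) t + excess k (X n) t" using k by (simp add: cut_add_excess)
        also have "\<dots> \<le> cut k (X n) t + excess k x t"
          using elim by (intro add_left_mono excess_mono) simp
        finally show ?case using k by (simp add: cut_nonneg excess_nonneg add.commute)
      qed
      from norm_le_add(2)[OF measurable[OF XE] xk cut(1) this]
      show ?case using m kd cut(2) by (simp add: k_def)
    qed
  qed
qed

text \<open>If \<open>x\<close> vanishes a.e., the limit condition carries no information about
  \<open>fundamental_fun N\<close>; order continuity is then checked directly.\<close>

lemma order_continuity_of_LLUKM:
  assumes "LLUKM_point E N x" "x \<in> L1"
    and lim: "((\<lambda>t. rearr x t * ereal (fundamental_fun N t)) \<longlongrightarrow> 0) (at_right 0)"
  shows "order_continuity_point E N x"
proof (cases "AE t in halfline. x t = 0")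
  case False
  have x: "x \<in> E" using assms by (simp add: LLUKM_point_def)
  show ?thesis
    by (rule order_continuity_of_excess[OF x assms(2) norm_excess_tendsto_0_of_LLUKM[OF assms(1)]
          fundamental_fun_at_0_of_rearr[OF measurable[OF x] False lim]])
next
  case True
  have x: "x \<in> E" using assms by (simp add: LLUKM_point_def)
  show ?thesis
    unfolding order_continuity_point_def
  proof (intro conjI x allI impI, elim conjE)
    fix X :: "nat \<Rightarrow> real \<Rightarrow> ereal"
    assume X: "\<forall>n. X n \<in> positive_cone E" "\<forall>n. AE t in halfline. X n t \<le> \<bar>x t\<bar>"
    have "N (X n) = 0" for n
    proof -
      have XE: "X n \<in> E" and X0: "AE t in halfline. 0 \<le> X n t"
        using X(1) by (auto simp: positive_cone_def)
      have "AE t in halfline. X n t = 0"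
        using True X0 X(2)[rule_format, of n]
      proof eventually_elim
        case (elim t)
        then show ?case by (intro antisym) simp_all
      qed
      then show ?thesis using norm_eq_0[OF XE] by simp
    qed
    then show "(\<lambda>n. N (X n)) \<longlonglongrightarrow> 0" by simp
  qed
qed

end

section \<open>From order continuity to LLUKM points\<close>

context fatou_symmetric_space
begin

text \<open>The difference is dominated by the excesses of \<open>Y n\<close> and \<open>z\<close>
  over a level \<open>k\<close> plus the difference \<open>W n\<close> of their truncations, and
  \<open>W n\<close> splits at \<open>T\<close> into a head \<open>H n\<close> and a tail
  \<open>R n\<close>. Each of the four pieces is given \<open>e / 4\<close>.\<close>

lemma decreasing_rcont_norm_diff_tendsto_0:
  assumes oc: "order_continuity_point E N x" and nz: "\<not> (AE t in halfline. x t = 0)"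
    and L1: "x \<in> L1" and phi: "((\<lambda>t. fundamental_fun N t / t) \<longlongrightarrow> 0) at_top"
    and Y: "\<And>n. decreasing_rcont (Y n)" and z: "decreasing_rcont z"
    and Y_le: "\<And>n t. 0 < t \<Longrightarrow> prim (Y n) t \<le> prim (rearr x) t"
    and z_le: "\<And>t. 0 < t \<Longrightarrow> prim z t \<le> prim (rearr x) t"
    and lim: "AE t in halfline. (\<lambda>n. Y n t) \<longlonglongrightarrow> z t"
  shows "(\<lambda>n. N (\<lambda>t. Y n t - z t)) \<longlonglongrightarrow> 0"
proof -
  have x: "x \<in> E" using oc by (simp add: order_continuity_point_def)
  let ?u = "rearr x"
  have u: "decreasing_rcont ?u" and uE: "?u \<in> E"
    using decreasing_rcont_rearr[OF measurable[OF x]] rearr_mem(1)[OF x] by auto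
  have YE: "Y n \<in> E" for n by (rule decreasing_submaj_norm_le(1)[OF Y u uE Y_le])
  have zE: "z \<in> E" by (rule decreasing_submaj_norm_le(1)[OF z u uE z_le])
  have Y0: "0 \<le> Y n t" and z0: "0 \<le> z t" for n t by (rule decreasing_rcontD(1)[OF Y], rule decreasing_rcontD(1)[OF z])
  have Y_meas [measurable]: "Y n \<in> borel_measurable halfline" for n
    using decreasing_rcont_L0[OF Y] by (simp add: L0_def)
  have z_meas [measurable]: "z \<in> borel_measurable halfline"
    using decreasing_rcont_L0[OF z] by (simp add: L0_def)
  have "(\<integral>\<^sup>+ t. e2ennreal (?u t) \<partial>halfline) < \<infinity>"
    using L1 by (simp add: nn_integral_rearr[OF measurable[OF x]] L1_def)
  then obtain B where B: "(\<integral>\<^sup>+ t. e2ennreal (?u t) \<partial>halfline) = ennreal B" "0 \<le> B"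
    by (cases "\<integral>\<^sup>+ t. e2ennreal (?u t) \<partial>halfline") auto
  have prim_u: "prim ?u t \<le> ennreal B" for t using prim_le_integral[of ?u t] B(1) by simp
  have Y_B: "Y n t \<le> ereal (B / t)" if "0 < t" for n t
    by (rule decreasing_rcont_le_prim[OF Y that order_trans[OF Y_le[OF that] prim_u] B(2)])
  have z_B: "z t \<le> ereal (B / t)" if "0 < t" for t
    by (rule decreasing_rcont_le_prim[OF z that order_trans[OF z_le[OF that] prim_u] B(2)])
  have int_Y: "(\<integral>\<^sup>+ t. e2ennreal (Y n t) \<partial>halfline) \<le> ennreal B" for n
    by (rule nn_integral_le_of_prim[OF decreasing_rcont_L0[OF Y] order_trans[OF Y_le prim_u]])
  have int_z: "(\<integral>\<^sup>+ t. e2ennreal (z t) \<partial>halfline) \<le> ennreal B"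
    by (rule nn_integral_le_of_prim[OF decreasing_rcont_L0[OF z] order_trans[OF z_le prim_u]])
  show ?thesis
  proof (rule order_tendstoI)
    fix a :: real assume "a < 0"
    then show "\<forall>\<^sub>F n in sequentially. a < N (\<lambda>t. Y n t - z t)"
      using norm_nonneg[OF diff_mem(1)[OF YE zE]] by (intro always_eventually allI) (rule less_le_trans)
  next
    fix e :: real assume e: "0 < e"
    have "\<forall>\<^sub>F n in sequentially. N (excess (real n) x) < e / 4"
      using norm_excess_tendsto_0[OF oc] e by (intro order_tendstoD(2)) auto
    then obtain m where "\<And>n. m \<le> n \<Longrightarrow> N (excess (real n) x) < e / 4"
      by (auto simp: eventually_sequentially)
    from this[of "Suc m"] have m: "N (excess (real (Suc m)) x) < e / 4" by (simp del: of_nat_Suc)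
    define k where "k = real (Suc m)"
    have k: "0 < k" by (simp add: k_def)
    have exc: "N (excess k x) < e / 4" using m by (simp only: k_def)
    have "0 < e / (4 * k)" using e k by simp
    from fundamental_fun_at_0_of_order_continuity[OF oc nz this]
    obtain d where d: "0 < d" "fundamental_fun N d < e / (4 * k)" by blast
    have kd: "k * fundamental_fun N d < e / 4" using d(2) k by (simp add: field_simps)
    \<comment> \<open>The tail will cost \<open>2 * B\<close> times
      \<open>fundamental_fun N (2 * T) / (2 * T)\<close>; the summand 1 covers
      \<open>B = 0\<close>.\<close>
    have "0 < e / (4 * (2 * B + 1))" using e B(2) by simp
    with phi have "\<forall>\<^sub>F t in at_top. fundamental_fun N t / t < e / (4 * (2 * B + 1))"
      by (rule order_tendstoD(2))
    then obtain T0 where T0: "\<And>t. T0 \<le> t \<Longrightarrow> fundamental_fun N t / t < e / (4 * (2 * B + 1))"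
      by (auto simp: eventually_at_top_linorder)
    define T where "T = max T0 1"
    have T: "0 < T" by (simp add: T_def)
    have T_small: "B / T * fundamental_fun N (2 * T) < e / 4"
    proof -
      define q where "q = fundamental_fun N (2 * T) / (2 * T)"
      have "T0 \<le> 2 * T" by (simp add: T_def max_def)
      from T0[OF this] have q: "q < e / (4 * (2 * B + 1))" by (simp add: q_def)
      have "B / T * fundamental_fun N (2 * T) = 2 * B * q" using T by (simp add: q_def)
      also have "\<dots> \<le> 2 * B * (e / (4 * (2 * B + 1)))" using q B(2) by (intro mult_left_mono) auto
      also have "\<dots> < (2 * B + 1) * (e / (4 * (2 * B + 1)))" using e B(2) by (intro mult_strict_right_mono) auto
      also have "\<dots> = e / 4" using B(2) by (simp add: field_simps)
      finally show ?thesis .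
    qed
    define W where "W n t = \<bar>cut k (Y n) t - cut k z t\<bar>" for n t
    define H where "H n t = W n t * indicator {0..<T} t" for n t
    define R where "R n t = W n t * indicator {T..} t" for n t
    have [measurable]: "{0..<T} \<in> sets halfline" "{T..} \<in> sets halfline"
      using T by (auto intro!: sets_halflineI)
    have W_meas [measurable]: "W n \<in> borel_measurable halfline" for n
      unfolding W_def[abs_def] cut_def by measurable
    have H_L0: "H n \<in> L0" and R_L0: "R n \<in> L0" for n
      unfolding L0_def H_def[abs_def] R_def[abs_def] by measurable
    have cut_real: "\<exists>r\<ge>0. cut k f t = ereal r \<and> r \<le> k" for f t
      using k by (cases "f t") (auto simp: cut_def min_def)
    have W_le: "0 \<le> W n t" "W n t \<le> ereal k" "W n t \<le> max (Y n t) (z t)" "W n t \<le> Y n t + z t" for n t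
    proof -
      obtain r1 r2 where r: "cut k (Y n) t = ereal r1" "0 \<le> r1" "r1 \<le> k"
        "cut k z t = ereal r2" "0 \<le> r2" "r2 \<le> k"
        using cut_real[of "Y n" t] cut_real[of z t] by blast
      have le: "ereal r1 \<le> Y n t" "ereal r2 \<le> z t"
        using r(1,4) Y0[of n t] z0[of t] by (simp_all add: cut_def min_def split: if_splits)
      have W: "W n t = ereal \<bar>r1 - r2\<bar>" by (simp add: W_def r)
      show "0 \<le> W n t" "W n t \<le> ereal k" using r by (auto simp: W)
      have "ereal \<bar>r1 - r2\<bar> \<le> max (ereal r1) (ereal r2)" using r by (simp add: max_def)
      also have "\<dots> \<le> max (Y n t) (z t)" using le by (rule max.mono)
      finally show "W n t \<le> max (Y n t) (z t)" by (simp add: W)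
      have "ereal \<bar>r1 - r2\<bar> \<le> ereal r1 + ereal r2" using r by simp
      also have "\<dots> \<le> Y n t + z t" using le by (rule add_mono)
      finally show "W n t \<le> Y n t + z t" by (simp add: W)
    qed
    \<comment> \<open>Beyond \<open>T\<close> both functions are at most \<open>B / T\<close>, and
      each has integral at most \<open>B\<close>. The total \<open>2 * B\<close> is
      \<open>B / T\<close> times \<open>2 * T\<close>, which explains the argument
      \<open>2 * T\<close>.\<close>
    have R: "R n \<in> E" "N (R n) \<le> B / T * fundamental_fun N (2 * T)" for n
    proof -
      have "AE t in halfline. \<bar>R n t\<bar> \<le> ereal (B / T)"
      proof (rule AE_I2)
        fix t
        show "\<bar>R n t\<bar> \<le> ereal (B / T)"
        proof (cases "T \<le> t")
          case True
          have "max (Y n t) (z t) \<le> ereal (B / T)"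
            using Y_B[OF T] z_B[OF T] decreasing_rcontD(2)[OF Y True] decreasing_rcontD(2)[OF z True]
            by (auto intro: order_trans)
          with W_le(3)[of n t] have "W n t \<le> ereal (B / T)" by (rule order_trans)
          then show ?thesis using W_le(1)[of n t] True by (simp add: R_def)
        next
          case False
          then show ?thesis using B(2) T by (simp add: R_def)
        qed
      qed
      moreover have "(\<integral>\<^sup>+ t. e2ennreal \<bar>R n t\<bar> \<partial>halfline) \<le> ennreal (B / T * (2 * T))"
      proof -
        have "(\<integral>\<^sup>+ t. e2ennreal \<bar>R n t\<bar> \<partial>halfline) \<le> (\<integral>\<^sup>+ t. e2ennreal (Y n t) + e2ennreal (z t) \<partial>halfline)"
        proof (rule nn_integral_mono)
          fix t
          have "\<bar>R n t\<bar> \<le> Y n t + z t"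
            using W_le(1,4)[of n t] Y0[of n t] z0[of t] by (auto simp: R_def indicator_def)
          then have "e2ennreal \<bar>R n t\<bar> \<le> e2ennreal (Y n t + z t)" by (rule e2ennreal_mono)
          also have "\<dots> = e2ennreal (Y n t) + e2ennreal (z t)"
            using Y0[of n t] z0[of t] by (cases "Y n t"; cases "z t") (auto simp: ennreal_plus)
          finally show "e2ennreal \<bar>R n t\<bar> \<le> e2ennreal (Y n t) + e2ennreal (z t)" .
        qed
        also have "\<dots> = (\<integral>\<^sup>+ t. e2ennreal (Y n t) \<partial>halfline) + (\<integral>\<^sup>+ t. e2ennreal (z t) \<partial>halfline)"
          by (rule nn_integral_add) measurable
        also have "\<dots> \<le> ennreal B + ennreal B" by (rule add_mono[OF int_Y int_z])
        also have "\<dots> = ennreal (B / T * (2 * T))" using B(2) T by (simp flip: ennreal_plus)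
        finally show ?thesis .
      qed
      ultimately show "R n \<in> E" "N (R n) \<le> B / T * fundamental_fun N (2 * T)"
        using norm_le_bounded_integrable[OF R_L0, of "B / T" "2 * T" n] B(2) T by simp_all
    qed
    \<comment> \<open>On the bounded interval \<open>[0, T)\<close> the truncated difference is
      dominated by the constant \<open>k\<close>.\<close>
    have "(\<lambda>n. \<integral>\<^sup>+ t. e2ennreal \<bar>H n t\<bar> \<partial>halfline) \<longlonglongrightarrow> (\<integral>\<^sup>+ t. 0 \<partial>halfline)"
    proof (rule nn_integral_dominated_convergence[where w = "\<lambda>t. ennreal k * indicator {0..<T} t"])
      show "(\<lambda>t. e2ennreal \<bar>H n t\<bar>) \<in> borel_measurable halfline" for n
        unfolding H_def by measurable
      show "AE t in halfline. e2ennreal \<bar>H n t\<bar> \<le> ennreal k * indicator {0..<T} t" for n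
      proof (rule AE_I2)
        fix t
        have "e2ennreal (W n t) \<le> ennreal k" using e2ennreal_mono[OF W_le(2)] by simp
        then show "e2ennreal \<bar>H n t\<bar> \<le> ennreal k * indicator {0..<T} t"
          using W_le(1)[of n t] by (simp add: H_def indicator_def e2ennreal_neg)
      qed
      have "(\<integral>\<^sup>+ t. ennreal k * indicator {0..<T} t \<partial>halfline) = ennreal k * ennreal T"
        using T by (subst nn_integral_cmult_indicator) (auto simp: emeasure_halfline_Ico)
      then show "(\<integral>\<^sup>+ t. ennreal k * indicator {0..<T} t \<partial>halfline) < \<infinity>"
        by (simp add: ennreal_mult_less_top)
      show "AE t in halfline. (\<lambda>n. e2ennreal \<bar>H n t\<bar>) \<longlonglongrightarrow> 0"
        using lim
      proof eventually_elim
        case (elim t)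
        have "(\<lambda>n. cut k (Y n) t) \<longlonglongrightarrow> cut k z t"
          unfolding cut_def using elim Y0 z0 by (simp add: tendsto_min)
        then have "(\<lambda>n. cut k (Y n) t - cut k z t) \<longlonglongrightarrow> cut k z t - cut k z t"
          using cut_real[of z t] by (intro tendsto_diff_ereal tendsto_const) auto
        then have "(\<lambda>n. \<bar>cut k (Y n) t - cut k z t\<bar>) \<longlonglongrightarrow> 0"
          using cut_real[of z t] tendsto_abs_ereal by force
        then have "(\<lambda>n. W n t) \<longlonglongrightarrow> 0" by (simp add: W_def)
        with continuous_at_e2ennreal have "(\<lambda>n. e2ennreal (W n t)) \<longlonglongrightarrow> e2ennreal 0"
          by (rule isCont_tendsto_compose)
        then show ?case
          using W_le(1) by (cases "t \<in> {0..<T}") (simp_all add: H_def e2ennreal_neg)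
      qed
    qed simp_all
    then have "\<forall>\<^sub>F n in sequentially. (\<integral>\<^sup>+ t. e2ennreal \<bar>H n t\<bar> \<partial>halfline) < ennreal (k * d)"
      using k d(1) by (intro order_tendstoD(2)) auto
    then show "\<forall>\<^sub>F n in sequentially. N (\<lambda>t. Y n t - z t) < e"
    proof eventually_elim
      case (elim n)
      have "AE t in halfline. \<bar>H n t\<bar> \<le> ereal k"
        using W_le(1,2) k by (intro AE_I2) (simp add: H_def indicator_def)
      from norm_le_bounded_integrable[OF H_L0 _ _ this less_imp_le[OF elim]]
      have H: "H n \<in> E" "N (H n) \<le> k * fundamental_fun N d" using k d(1) by simp_all
      have W: "W n \<in> E" "N (W n) \<le> N (H n) + N (R n)"
      proof -
        have "AE t in halfline. \<bar>W n t\<bar> \<le> \<bar>H n t\<bar> + \<bar>R n t\<bar>"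
          using T by (intro AE_I2) (auto simp: H_def R_def indicator_def)
        moreover have "W n \<in> L0" by (simp add: L0_def)
        ultimately show "W n \<in> E" "N (W n) \<le> N (H n) + N (R n)"
          using norm_le_add[OF _ H(1) R(1)] by blast+
      qed
      have eY: "excess k (Y n) \<in> E" "N (excess k (Y n)) \<le> N (excess k ?u)"
        using norm_excess_submaj_le[OF Y u uE less_imp_le[OF k] Y_le] by blast+
      have ez: "excess k z \<in> E" "N (excess k z) \<le> N (excess k ?u)"
        using norm_excess_submaj_le[OF z u uE less_imp_le[OF k] z_le] by blast+
      let ?e = "\<lambda>t. excess k (Y n) t + excess k z t"
      have eE: "?e \<in> E" "N ?e \<le> N (excess k (Y n)) + N (excess k z)"
        by (rule add[OF eY(1) ez(1)], rule norm_triangle[OF eY(1) ez(1)])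
      have "AE t in halfline. \<bar>Y n t - z t\<bar> \<le> \<bar>?e t\<bar> + \<bar>W n t\<bar>"
        using ae_finite[OF YE[of n]] ae_finite[OF zE]
      proof eventually_elim
        case (elim t)
        then obtain y1 z1 where "Y n t = ereal y1" "z t = ereal z1" by (cases "Y n t"; cases "z t") auto
        then show ?case using Y0[of n t] z0[of t] k
          by (auto simp: W_def cut_def excess_def zero_ereal_def max_def min_def abs_if)
      qed
      from norm_le_add(2)[OF measurable[OF diff_mem(1)[OF YE zE]] eE(1) W(1) this]
      have "N (\<lambda>t. Y n t - z t) \<le> N ?e + N (W n)" .
      then show ?case
        using eE(2) eY(2) ez(2) W(2) H(2) R(2)[of n] exc kd T_small
        unfolding norm_excess_rearr[OF less_imp_le[OF k] x] by linarith
    qed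
  qed
qed

lemma LLUKM_of_LKM_order_continuity:
  assumes lkm: "LKM_point E N x" and oc: "order_continuity_point E N x"
    and L1: "x \<in> L1" and phi: "((\<lambda>t. fundamental_fun N t / t) \<longlongrightarrow> 0) at_top"
  shows "LLUKM_point E N x"
proof (rule LLUKM_pointI)
  show x: "x \<in> E" using oc by (simp add: order_continuity_point_def)
  fix X :: "nat \<Rightarrow> real \<Rightarrow> ereal"
  assume XE: "\<And>n. X n \<in> E" and sub: "\<And>n. submaj (X n) x" and NX: "(\<lambda>n. N (X n)) \<longlonglongrightarrow> N x"
  let ?u = "rearr x"
  let ?D = "\<lambda>n. N (\<lambda>t. ?u t - rearr (X n) t)"
  have u: "decreasing_rcont ?u" and uE: "?u \<in> E"
    using decreasing_rcont_rearr[OF measurable[OF x]] rearr_mem(1)[OF x] by auto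
  have D0: "0 \<le> ?D n" for n by (rule norm_nonneg[OF diff_mem(1)[OF uE rearr_mem(1)[OF XE]]])
  show "?D \<longlonglongrightarrow> 0"
  \<comment> \<open>For \<open>x = 0\<close> a.e. order continuity does not control
    \<open>fundamental_fun N\<close> at \<open>0\<close>; but then \<open>N x = 0\<close> and the
    differences are bounded by \<open>N (X n)\<close>.\<close>
  proof (cases "AE t in halfline. x t = 0")
    case True
    then have Nx: "N x = 0" using norm_eq_0[OF x] by simp
    have "?D n \<le> N (X n)" for n
      using diff_mem(2)[OF uE rearr_mem(1)[OF XE]] rearr_mem(2)[OF x] rearr_mem(2)[OF XE] Nx by simp
    then show ?thesis
      by (intro tendsto_sandwich[OF _ _ tendsto_const NX[unfolded Nx]] always_eventually allI D0)
  next
    case nz: False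
    show ?thesis
    proof (rule ccontr)
      assume "\<not> ?D \<longlonglongrightarrow> 0"
      then obtain e where e: "0 < e" "\<And>m. \<exists>n\<ge>m. e \<le> ?D n"
        unfolding LIMSEQ_def dist_real_def diff_0_right abs_of_nonneg[OF D0] not_all not_ex not_imp not_less
        by blast
      \<comment> \<open>A subsequence staying at distance \<open>e\<close> is fixed first; the
        contradiction comes from a convergent subsequence of it.\<close>
      then have "infinite {n. e \<le> ?D n}" unfolding infinite_nat_iff_unbounded_le mem_Collect_eq by blast
      from infinite_enumerate[OF this] obtain s :: "nat \<Rightarrow> nat"
        where s: "strict_mono s" and "\<forall>n. s n \<in> {n. e \<le> ?D n}" by blast
      then have s_ge: "e \<le> ?D (s n)" for n by simp
      define Y where "Y n = rearr (X (s n))" for n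
      have Y: "decreasing_rcont (Y n)" for n
        unfolding Y_def by (rule decreasing_rcont_rearr[OF measurable[OF XE]])
      have Y_le: "prim (Y n) t \<le> prim ?u t" if "0 < t" for n t
        using sub that unfolding submaj_iff Y_def by blast
      have "(\<integral>\<^sup>+ t. e2ennreal (?u t) \<partial>halfline) < \<infinity>"
        using L1 by (simp add: nn_integral_rearr[OF measurable[OF x]] L1_def)
      then obtain B where B: "(\<integral>\<^sup>+ t. e2ennreal (?u t) \<partial>halfline) = ennreal B" "0 \<le> B"
        by (cases "\<integral>\<^sup>+ t. e2ennreal (?u t) \<partial>halfline") auto
      have prim_u: "prim ?u t \<le> ennreal B" for t using prim_le_integral[of ?u t] B(1) by simp
      have Y_B: "Y n t \<le> ereal (B / t)" if "0 < t" for n t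
        by (rule decreasing_rcont_le_prim[OF Y that order_trans[OF Y_le[OF that] prim_u] B(2)])
      obtain r z where r: "strict_mono r" and z: "decreasing_rcont z"
        and lim: "AE t in halfline. (\<lambda>n. Y (r n) t) \<longlonglongrightarrow> z t"
        by (rule decreasing_rcont_selection[where Y = Y and B = "\<lambda>t. B / t", OF Y Y_B])
      have [measurable]: "Y n \<in> borel_measurable halfline" for n
        using decreasing_rcont_L0[OF Y] by (simp add: L0_def)
      \<comment> \<open>Fatou's lemma for integrals: submajorization by \<open>x\<close> survives
        the a.e. limit.\<close>
      have z_le: "prim z t \<le> prim ?u t" if t: "0 < t" for t
      proof -
        have [measurable]: "{0..t} \<in> sets halfline" by (auto intro: sets_halflineI)
        have "prim z t = (\<integral>\<^sup>+ a. liminf (\<lambda>n. e2ennreal (Y (r n) a) * indicator {0..t} a) \<partial>halfline)"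
          unfolding prim_def
        proof (rule nn_integral_cong_AE)
          show "AE a in halfline. e2ennreal (z a) * indicator {0..t} a
              = liminf (\<lambda>n. e2ennreal (Y (r n) a) * indicator {0..t} a)"
            using lim
          proof eventually_elim
            case (elim a)
            have "(\<lambda>n. e2ennreal (Y (r n) a)) \<longlonglongrightarrow> e2ennreal (z a)"
              using continuous_at_e2ennreal elim by (rule isCont_tendsto_compose)
            then have "(\<lambda>n. e2ennreal (Y (r n) a) * indicator {0..t} a) \<longlonglongrightarrow> e2ennreal (z a) * indicator {0..t} a"
              by (cases "a \<in> {0..t}") simp_all
            from lim_imp_Liminf[OF _ this] show ?case by simp
          qed
        qed
        also have "\<dots> \<le> liminf (\<lambda>n. \<integral>\<^sup>+ a. e2ennreal (Y (r n) a) * indicator {0..t} a \<partial>halfline)"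
          by (rule nn_integral_liminf) measurable
        also have "\<dots> \<le> liminf (\<lambda>n. prim ?u t)"
          using Y_le[OF t] by (intro Liminf_mono always_eventually allI) (simp add: prim_def)
        also have "\<dots> = prim ?u t" by (simp add: Liminf_const)
        finally show ?thesis .
      qed
      have zE: "z \<in> E" by (rule decreasing_submaj_norm_le(1)[OF z u uE z_le])
      have YE: "Y n \<in> E" for n unfolding Y_def by (rule rearr_mem(1)[OF XE])
      have conv: "(\<lambda>n. N (\<lambda>t. Y (r n) t - z t)) \<longlonglongrightarrow> 0"
        by (rule decreasing_rcont_norm_diff_tendsto_0[OF oc nz L1 phi Y z Y_le z_le lim])
      have NY: "(\<lambda>n. N (Y (r n))) \<longlonglongrightarrow> N x"
      proof -
        have "strict_mono (s \<circ> r)" using s r by (rule strict_mono_o)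
        from LIMSEQ_subseq_LIMSEQ[OF NX this] show ?thesis
          by (simp add: o_def Y_def rearr_mem(2)[OF XE])
      qed
      \<comment> \<open>Norm convergence transfers the limit \<open>N x\<close> of the norms to
        \<open>z\<close>. As \<open>z\<close> is submajorized by \<open>x\<close>, the LKM property
        then forces its rearrangement, which is \<open>z\<close> itself, to equal
        \<open>rearr x\<close>.\<close>
      have "N x \<le> N z + 0"
        using norm_triangle_diff[OF YE zE]
        by (intro LIMSEQ_le[OF NY tendsto_add[OF tendsto_const conv]]) blast
      then have "\<not> N z < N x" by simp
      moreover have "submaj z x"
        unfolding submaj_iff using z_le prim_rearr_decreasing_rcont[OF z] by simp
      ultimately have "\<not> (\<exists>t\<ge>0. ?u t \<noteq> rearr z t)"
        using lkm zE unfolding LKM_point_def by blast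
      then have eq: "?u t = z t" if "0 \<le> t" for t using rearr_decreasing_rcont[OF z that] that by simp
      have "?D (s (r n)) = N (\<lambda>t. Y (r n) t - z t)" for n
      proof -
        have "N (\<lambda>t. Y (r n) t - z t) = N (\<lambda>t. z t - Y (r n) t)" by (rule norm_diff_commute[OF YE zE])
        also have "\<dots> = N (\<lambda>t. ?u t - Y (r n) t)"
          by (rule norm_cong_abs_AE(2)[OF diff_mem(1)[OF uE YE] measurable[OF diff_mem(1)[OF zE YE]]])
            (intro AE_I2, simp add: eq)
        finally show ?thesis by (simp add: Y_def)
      qed
      then have "e \<le> N (\<lambda>t. Y (r n) t - z t)" for n using s_ge[of "r n"] by simp
      with conv have "e \<le> 0" using LIMSEQ_le_const by blast
      then show False using e(1) by simp
    qed
    qed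
qed

end

theorem theorem3p7:
  fixes E :: "(real \<Rightarrow> ereal) set"
    and N :: "(real \<Rightarrow> ereal) \<Rightarrow> real"
    and x :: "real \<Rightarrow> ereal"
  assumes "symmetric_space E N"
    and "fatou_property E N"
    and "((\<lambda>t. fundamental_fun N t / t) \<longlongrightarrow> 0) at_top"
    and "x \<in> E" and "x \<in> L1"
  shows "(LLUKM_point E N x \<and>
            ((\<lambda>t. rearr x t * ereal (fundamental_fun N t)) \<longlongrightarrow> 0) (at_right 0))
     \<longleftrightarrow> (LKM_point E N x \<and> order_continuity_point E N x)"
proof -
  interpret fatou_symmetric_space E N
    by (intro fatou_symmetric_space.intro fatou_symmetric_space_axioms.intro assms(1,2))
  show ?thesis
    using LKM_of_LLUKM[of x] order_continuity_of_LLUKM[of x] rearr_tendsto_0_of_order_continuity[of x]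
      LLUKM_of_LKM_order_continuity[of x] assms(3,5)
    by blast
qed

end
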